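(* Let $N\ge 1$, let $x$ be a complex parameter, and let $R\in SO(2N)$ be a real special orthogonal matrix. Then $$\exp(x\,\mathrm{Tr}\,R)=\sum_{n_1\ge n_2\ge\cdots\ge n_N\ge 0}\frac12\det\left[I_{n_j+i-j}(2x)+I_{n_j+2N-i-j}(2x)\right]\mathcal C_{(n_1,\dots,n_N)}(R),$$ where the determinant is of the $N\times N$ matrix with the displayed entry in row $i$ and column $j$.
   Context: $I_\lambda$ is the modified Bessel function: for integers $\lambda\ge 0$, $I_\lambda(x)=\sum_{p=0}^{\infty}\frac{1}{p!(p+\lambda)!}\left(\frac{x}{2}\right)^{2p+\lambda}$, and $I_{-\lambda}=I_\lambda$. The eigenvalues of $R$ are $t_1,\dots,t_N,t_1^{-1},\dots,t_N^{-1}$ with $|t_i|=1$. For integers $n_1\ge\cdots\ge n_N\ge 0$ define $$\mathcal C_{(n_1,\dots,n_N)}(R)=\frac{\det\left[t_i^{n_j+N-j}+t_i^{-(n_j+N-j)}-\delta_{jN}\delta_{n_N 0}\right]}{\det\left[t_i^{N-j}+t_i^{-(N-j)}-\delta_{jN}\right]}$$ ($N\times N$ determinants, row $i$, column $j$, with $\delta$ the Kronecker delta; the ratio is a Laurent polynomial in the $t_i$, and is interpreted as such where the denominator vanishes). It is a simple character of $SO(2N)$ if $n_N=0$ and a sum of two simple characters if $n_N>0$. The sum runs over all integer tuples $n_1\ge\cdots\ge n_N\ge 0$. *)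

theory Defs
  imports "HOL-Analysis.Infinite_Sum" "HOL-Library.FuncSet" "Jordan_Normal_Form.Char_Poly"
begin

definition special_orthogonal :: "nat \<Rightarrow> real mat set" where
  "special_orthogonal m =
     {R. R \<in> carrier_mat m m \<and> R * transpose_mat R = 1\<^sub>m m \<and> det R = 1}"

definition mat_trace :: "'a :: comm_monoid_add mat \<Rightarrow> 'a" where
  "mat_trace A = (\<Sum>i<dim_row A. A $$ (i, i))"

definition bessel_I :: "int \<Rightarrow> complex \<Rightarrow> complex" where
  "bessel_I l x =
     (\<Sum>p. (x / 2) ^ (2 * p + nat \<bar>l\<bar>) / (fact p * fact (p + nat \<bar>l\<bar>)))"

(* Determinant of an N x N matrix given by its entries in row i, column j, 1 \<le> i, j \<le> N
   (matrix indices of the library start at 0). *)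
definition det1 :: "nat \<Rightarrow> (nat \<Rightarrow> nat \<Rightarrow> complex) \<Rightarrow> complex" where
  "det1 N f = det (mat N N (\<lambda>(i, j). f (i + 1) (j + 1)))"

(* Tuples indexed by 1, ..., N, extended by undefined outside this range so that distinct
   elements are distinct tuples. *)
definition weights :: "nat \<Rightarrow> (nat \<Rightarrow> nat) set" where
  "weights N = {n \<in> {1..N} \<rightarrow>\<^sub>E UNIV. \<forall>i\<in>{1..N}. \<forall>j\<in>{1..N}. i \<le> j \<longrightarrow> n i \<ge> n j}"

definition char_numer :: "nat \<Rightarrow> (nat \<Rightarrow> nat) \<Rightarrow> (nat \<Rightarrow> complex) \<Rightarrow> complex" where
  "char_numer N n t = det1 N (\<lambda>i j.
     t i powi (int (n j) + int N - int j) + t i powi (- (int (n j) + int N - int j))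
     - of_bool (j = N) * of_bool (n N = 0))"

definition char_denom :: "nat \<Rightarrow> (nat \<Rightarrow> complex) \<Rightarrow> complex" where
  "char_denom N t = det1 N (\<lambda>i j.
     t i powi (int N - int j) + t i powi (- (int N - int j)) - of_bool (j = N))"

definition laurent_polynomial :: "nat \<Rightarrow> ((nat \<Rightarrow> complex) \<Rightarrow> complex) \<Rightarrow> bool" where
  "laurent_polynomial N L \<longleftrightarrow>
     (\<exists>K :: (nat \<Rightarrow> int) set. \<exists>c :: (nat \<Rightarrow> int) \<Rightarrow> complex. finite K \<and>
        (\<forall>t. L t = (\<Sum>k\<in>K. c k * (\<Prod>i=1..N. t i powi k i))))"

(* The ratio char_numer / char_denom as a Laurent polynomial in t 1, ..., t N.  Its values at
   points with all t i \<noteq> 0 do not depend on the choice: the denominator is a nonzero Laurent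
   polynomial, so two such L agree there. *)
definition char_laurent :: "nat \<Rightarrow> (nat \<Rightarrow> nat) \<Rightarrow> (nat \<Rightarrow> complex) \<Rightarrow> complex" where
  "char_laurent N n = (SOME L. laurent_polynomial N L \<and>
     (\<forall>t. (\<forall>i\<in>{1..N}. t i \<noteq> 0) \<and> char_denom N t \<noteq> 0 \<longrightarrow>
        L t = char_numer N n t / char_denom N t))"

(* The eigenvalues of R, with multiplicity, are t 1, ..., t N and their inverses. *)
definition eigenvalue_params :: "nat \<Rightarrow> real mat \<Rightarrow> (nat \<Rightarrow> complex) \<Rightarrow> bool" where
  "eigenvalue_params N R t \<longleftrightarrow>
     (\<forall>i\<in>{1..N}. cmod (t i) = 1) \<and>
     char_poly (map_mat complex_of_real R) = (\<Prod>i=1..N. [:- t i, 1:] * [:- inverse (t i), 1:])"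

(* For R in SO(2N) such t exist and are unique up to permuting the t i and inverting some of
   them; char_laurent is invariant under these operations, so the choice is immaterial. *)
definition SO_char :: "nat \<Rightarrow> (nat \<Rightarrow> nat) \<Rightarrow> real mat \<Rightarrow> complex" where
  "SO_char N n R = char_laurent N n (SOME t. eigenvalue_params N R t)"

end

(* Put z_i = t_i + 1/t_i and let Z be the upper bidiagonal matrix with diagonal z_1, ..., z_N and
   superdiagonal 1.  Let p_m be the polynomials with p_m(t + 1/t) = t^m + t^-m (halved for m = 0).
   The vectors u_m = p_m(Z) e_N are polynomial in the z_i, and multiplying the matrix with columns
   u_(m_1), ..., u_(m_N) by the left eigenvectors of Z turns its entries into p_(m_j)(z_i).  With
   m_j = n_j + N - j this identifies the character with det[u_(m_1), ..., u_(m_N)], without any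
   division, so that coinciding eigenvalues need no limiting argument.

   The generating function of the Bessel functions gives exp(x Z) = sum_m I_m(2x) p_m(Z), and the
   product formula p_k p_m = p_(m+k) + p_(m-k) expands each column of exp(x Z) [u_(N-1), ..., u_0]
   in the u_m, the coefficients being I_(m-k)(2x) + I_(m+k)(2x).  The determinant of this product is
   det exp(x Z) = exp(x Tr R), since [u_(N-1), ..., u_0] is unitriangular.  Expanding it by a
   Cauchy-Binet formula with infinitely many columns yields the series. *)

theory Submission
  imports Defs "Jordan_Normal_Form.Schur_Decomposition"
begin

section \<open>A Cauchy-Binet formula with infinitely many columns\<close>

text \<open>The matrix Z is bidiagonal rather than diagonal because e_N is a cyclic vector of the
  bidiagonal matrix whatever its eigenvalues, while a diagonal matrix has one only if they are
  distinct. The determinant of the left eigenvectors, the product of all z_i - z_k with i < k, is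
  the common factor of numerator and denominator of the character; it may vanish, but it splits off
  as an identity. The factor 1/2 of the theorem comes from u_0, which is half of p(Z) e_N for the
  polynomial with value t^0 + t^-0 = 2: the row of coefficients with k = 0 holds I_m instead of 2
  I_m. All rearrangements rest on absolute convergence: the entries of p_m(Z) grow at most
  geometrically in m, and the Bessel functions decay faster than any geometric sequence. One limit
  remains, for a different purpose: the character is defined through an arbitrary choice among the
  Laurent polynomials that agree with the quotient, and this choice has to be identified at every
  point. The condition det R = 1 is what makes the eigenvalues 1 and -1 occur in pairs.\<close>

lemma abs_summable_prod_PiE:
  fixes f :: "'a \<Rightarrow> 'b \<Rightarrow> complex"
  assumes "finite A" and "\<And>x. x \<in> A \<Longrightarrow> f x abs_summable_on B x"
  shows "(\<lambda>g. \<Prod>x\<in>A. f x (g x)) abs_summable_on PiE A B"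
  using assms
proof (induction A)
  case empty
  then show ?case by simp
next
  case (insert a A)
  let ?h = "\<lambda>(y, g). g(a := y)"
  have inj: "inj_on ?h (B a \<times> PiE A B)"
    using insert.hyps(2) by (rule inj_combinator)
  have eq: "(\<lambda>g. norm (\<Prod>x\<in>insert a A. f x (g x))) \<circ> ?h
      = (\<lambda>(y, g). norm (f a y * (\<Prod>x\<in>A. f x (g x))))"
  proof (rule ext, clarify)
    fix y g
    have "(\<Prod>x\<in>A. f x ((g(a := y)) x)) = (\<Prod>x\<in>A. f x (g x))"
      using insert.hyps(2) by (intro prod.cong) auto
    then show "((\<lambda>g. norm (\<Prod>x\<in>insert a A. f x (g x))) \<circ> ?h) (y, g)
        = norm (f a y * (\<Prod>x\<in>A. f x (g x)))"
      using insert.hyps by simp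
  qed
  have ih: "(\<lambda>g. \<Prod>x\<in>A. f x (g x)) abs_summable_on PiE A B"
    using insert by auto
  have "(\<lambda>(y, g). f a y * (\<Prod>x\<in>A. f x (g x))) abs_summable_on (B a \<times> PiE A B)"
    unfolding abs_summable_on_Sigma_iff
  proof (intro conjI ballI)
    fix y assume "y \<in> B a"
    show "(\<lambda>g. (\<lambda>(y, g). f a y * (\<Prod>x\<in>A. f x (g x))) (y, g)) abs_summable_on PiE A B"
      unfolding prod.case norm_mult using ih by (rule summable_on_cmult_right)
  next
    let ?I = "\<Sum>\<^sub>\<infinity>g\<in>PiE A B. norm (\<Prod>x\<in>A. f x (g x))"
    have "(\<Sum>\<^sub>\<infinity>g\<in>PiE A B. norm ((\<lambda>(y, g). f a y * (\<Prod>x\<in>A. f x (g x))) (y, g))) = norm (f a y) * ?I" for y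
      unfolding prod.case norm_mult by (rule infsum_cmult_right')
    moreover have "0 \<le> ?I"
      by (rule infsum_nonneg) simp
    moreover have "(\<lambda>y. norm (f a y) * ?I) summable_on B a"
      by (rule summable_on_cmult_left) (use insert.prems in simp)
    ultimately show "(\<lambda>y. \<Sum>\<^sub>\<infinity>g\<in>PiE A B. norm ((\<lambda>(y, g). f a y * (\<Prod>x\<in>A. f x (g x))) (y, g)))
        abs_summable_on B a"
      by (simp only: norm_mult real_norm_def abs_mult abs_of_nonneg abs_norm_cancel)
  qed
  then have "((\<lambda>g. norm (\<Prod>x\<in>insert a A. f x (g x))) \<circ> ?h) summable_on (B a \<times> PiE A B)"
    unfolding eq by (simp add: case_prod_unfold)
  then show ?case
    unfolding PiE_insert_eq by (rule summable_on_reindex[OF inj, THEN iffD2])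
qed

lemma has_sum_prod_PiE:
  fixes f :: "'a \<Rightarrow> 'b \<Rightarrow> complex"
  assumes "finite A" and "\<And>x. x \<in> A \<Longrightarrow> f x abs_summable_on B x"
  shows "((\<lambda>g. \<Prod>x\<in>A. f x (g x)) has_sum (\<Prod>x\<in>A. infsum (f x) (B x))) (PiE A B)"
  using has_sum_infsum[OF abs_summable_summable[OF abs_summable_prod_PiE[OF assms]]]
  by (simp only: infsum_prod_PiE_abs[OF assms])

section \<open>Sorting tuples of column indices\<close>

definition decreasing_tuples :: "nat \<Rightarrow> (nat \<Rightarrow> nat) set" where
  "decreasing_tuples N = {\<nu> \<in> {0..<N} \<rightarrow>\<^sub>E UNIV. \<forall>i<N. \<forall>j<i. \<nu> i < \<nu> j}"

lemma decreasing_tuples_inj_on: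
  assumes "\<nu> \<in> decreasing_tuples N"
  shows "inj_on \<nu> {0..<N}"
proof (rule linorder_inj_onI)
  fix i j assume "i < j" "i \<in> {0..<N}" "j \<in> {0..<N}"
  then have "\<nu> j < \<nu> i"
    using assms by (simp add: decreasing_tuples_def)
  then show "\<nu> i \<noteq> \<nu> j" by simp
qed auto

lemma decreasing_tuples_eqI:
  assumes "\<nu> \<in> decreasing_tuples N" "\<nu>' \<in> decreasing_tuples N" "\<nu> ` {0..<N} = \<nu>' ` {0..<N}"
  shows "\<nu> = \<nu>'"
proof -
  \<comment> \<open>Reversal makes the list strictly increasing, and such a list is determined by
    its set of elements.\<close>
  have s: "sorted_wrt (<) (map \<nu> (rev [0..<N]))" if "\<nu> \<in> decreasing_tuples N" for \<nu>
    using that unfolding decreasing_tuples_def sorted_wrt_map sorted_wrt_rev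
    by (auto simp: sorted_wrt_iff_nth_less)
  have "map \<nu> (rev [0..<N]) = map \<nu>' (rev [0..<N])"
    using s assms by (intro strict_sorted_equal) auto
  then have "\<nu> i = \<nu>' i" if "i < N" for i
    using that by auto
  then show ?thesis
    using assms(1,2) by (intro PiE_ext[of \<nu> "{0..<N}" "\<lambda>_. UNIV"]) (simp_all add: decreasing_tuples_def)
qed

lemma decreasing_tuples_obtain:
  fixes A :: "nat set"
  assumes "finite A" "card A = N"
  obtains \<nu> where "\<nu> \<in> decreasing_tuples N" "\<nu> ` {0..<N} = A"
proof -
  define l where "l = rev (sorted_list_of_set A)"
  define \<nu> where "\<nu> = restrict (\<lambda>i. l ! i) {0..<N}"
  have len: "length l = N" using assms by (simp add: l_def)
  have "sorted_wrt (>) l" by (simp add: l_def sorted_wrt_rev)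
  then have "\<nu> \<in> decreasing_tuples N"
    using len by (auto simp: decreasing_tuples_def \<nu>_def sorted_wrt_iff_nth_less)
  moreover have "\<nu> ` {0..<N} = set l"
    unfolding \<nu>_def using len by (auto simp: set_conv_nth)
  then have "\<nu> ` {0..<N} = A" using assms by (simp add: l_def)
  ultimately show thesis by (rule that)
qed

text \<open>An injective tuple amounts to its image, listed in decreasing order, together with the
  permutation that arranges it.\<close>

lemma bij_betw_decreasing_tuples_permutations:
  "bij_betw (\<lambda>(\<nu>, \<sigma>). restrict (\<nu> \<circ> \<sigma>) {0..<N})
     (decreasing_tuples N \<times> {\<sigma>. \<sigma> permutes {0..<N}})
     {\<mu> \<in> {0..<N} \<rightarrow>\<^sub>E UNIV. inj_on \<mu> {0..<N}}"
  unfolding bij_betw_def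
proof (intro conjI)
  show "inj_on (\<lambda>(\<nu>, \<sigma>). restrict (\<nu> \<circ> \<sigma>) {0..<N})
     (decreasing_tuples N \<times> {\<sigma>. \<sigma> permutes {0..<N}})"
  proof (rule inj_onI, clarify)
    fix \<nu> \<sigma> \<nu>' \<sigma>'
    assume nu: "\<nu> \<in> decreasing_tuples N" "\<nu>' \<in> decreasing_tuples N"
      and p: "\<sigma> permutes {0..<N}" "\<sigma>' permutes {0..<N}"
      and eq: "restrict (\<nu> \<circ> \<sigma>) {0..<N} = restrict (\<nu>' \<circ> \<sigma>') {0..<N}"
    have pt: "\<nu> (\<sigma> i) = \<nu>' (\<sigma>' i)" if "i < N" for i
      using fun_cong[OF eq, of i] that by simp
    have "\<nu> ` {0..<N} = (\<nu> \<circ> \<sigma>) ` {0..<N}"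
      by (metis image_comp p(1) permutes_image)
    also have "\<dots> = (\<nu>' \<circ> \<sigma>') ` {0..<N}" using pt by auto
    also have "\<dots> = \<nu>' ` {0..<N}" by (metis image_comp p(2) permutes_image)
    finally have e: "\<nu> = \<nu>'" using nu by (intro decreasing_tuples_eqI)
    have "\<sigma> i = \<sigma>' i" for i
    proof (cases "i < N")
      case True
      then have "\<sigma> i \<in> {0..<N}" "\<sigma>' i \<in> {0..<N}"
        using permutes_in_image[OF p(1), of i] permutes_in_image[OF p(2), of i] by simp_all
      then show ?thesis
        using pt[OF True] e by (simp add: inj_on_eq_iff[OF decreasing_tuples_inj_on[OF nu(2)]])
    next
      case False
      then show ?thesis using permutes_not_in[OF p(1), of i] permutes_not_in[OF p(2), of i] by simp
    qed
    then have "\<sigma> = \<sigma>'" by (rule ext)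
    with e show "\<nu> = \<nu>' \<and> \<sigma> = \<sigma>'" by (rule conjI)
  qed
  show "(\<lambda>(\<nu>, \<sigma>). restrict (\<nu> \<circ> \<sigma>) {0..<N}) `
      (decreasing_tuples N \<times> {\<sigma>. \<sigma> permutes {0..<N}})
      = {\<mu> \<in> {0..<N} \<rightarrow>\<^sub>E UNIV. inj_on \<mu> {0..<N}}"
  proof (intro equalityI subsetI)
    fix \<mu> assume "\<mu> \<in> (\<lambda>(\<nu>, \<sigma>). restrict (\<nu> \<circ> \<sigma>) {0..<N}) `
      (decreasing_tuples N \<times> {\<sigma>. \<sigma> permutes {0..<N}})"
    then obtain \<nu> \<sigma> where h: "\<nu> \<in> decreasing_tuples N" "\<sigma> permutes {0..<N}"
      "\<mu> = restrict (\<nu> \<circ> \<sigma>) {0..<N}" by auto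
    have "inj_on (\<nu> \<circ> \<sigma>) {0..<N}"
      using decreasing_tuples_inj_on[OF h(1)] h(2)
      by (intro comp_inj_on) (auto simp: permutes_image permutes_inj_on)
    with h(3) show "\<mu> \<in> {\<mu> \<in> {0..<N} \<rightarrow>\<^sub>E UNIV. inj_on \<mu> {0..<N}}" by simp
  next
    fix \<mu> :: "nat \<Rightarrow> nat" assume "\<mu> \<in> {\<mu> \<in> {0..<N} \<rightarrow>\<^sub>E UNIV. inj_on \<mu> {0..<N}}"
    then have mu: "\<mu> \<in> {0..<N} \<rightarrow>\<^sub>E UNIV" "inj_on \<mu> {0..<N}" by auto
    obtain \<nu> where nu: "\<nu> \<in> decreasing_tuples N" "\<nu> ` {0..<N} = \<mu> ` {0..<N}"
      using decreasing_tuples_obtain[of "\<mu> ` {0..<N}" N] mu(2) by (auto simp: card_image)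
    have bnu: "bij_betw (inv_into {0..<N} \<nu>) (\<mu> ` {0..<N}) {0..<N}"
      using nu(2) decreasing_tuples_inj_on[OF nu(1)] by (intro bij_betw_inv_into) (simp add: bij_betw_def)
    \<comment> \<open>The permutation has to be the inverse of \<nu> after \<mu>, extended by the
      identity outside the index range.\<close>
    define \<sigma> where "\<sigma> i = (if i \<in> {0..<N} then inv_into {0..<N} \<nu> (\<mu> i) else i)" for i
    have "bij_betw (inv_into {0..<N} \<nu> \<circ> \<mu>) {0..<N} {0..<N}"
      using bij_betw_trans[OF _ bnu, of \<mu> "{0..<N}"] mu(2) by (simp add: bij_betw_def)
    then have "bij_betw \<sigma> {0..<N} {0..<N}"
      by (rule bij_betw_cong[THEN iffD1, rotated]) (simp add: \<sigma>_def)
    then have s: "\<sigma> permutes {0..<N}"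
      by (rule bij_imp_permutes) (auto simp: \<sigma>_def)
    have eq: "\<mu> = restrict (\<nu> \<circ> \<sigma>) {0..<N}"
    proof
      fix i show "\<mu> i = restrict (\<nu> \<circ> \<sigma>) {0..<N} i"
      proof (cases "i \<in> {0..<N}")
        case True
        then have "\<mu> i \<in> \<nu> ` {0..<N}" using nu by simp
        then show ?thesis using True by (simp add: \<sigma>_def f_inv_into_f)
      next
        case False
        then show ?thesis using PiE_arb[OF mu(1) False] by (simp add: restrict_def)
      qed
    qed
    show "\<mu> \<in> (\<lambda>(\<nu>, \<sigma>). restrict (\<nu> \<circ> \<sigma>) {0..<N}) `
      (decreasing_tuples N \<times> {\<sigma>. \<sigma> permutes {0..<N}})"
      by (rule image_eqI[of _ _ "(\<nu>, \<sigma>)"]) (use nu(1) s in \<open>simp_all only: eq prod.case mem_Times_iff fst_conv snd_conv mem_Collect_eq simp_thms\<close>)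
  qed
qed

lemma det_mat_eq:
  "det (mat N N f) = (\<Sum>\<sigma> | \<sigma> permutes {0..<N}. signof \<sigma> * (\<Prod>i = 0..<N. f (i, \<sigma> i)))"
proof -
  have "(\<Prod>i = 0..<N. mat N N f $$ (i, \<sigma> i)) = (\<Prod>i = 0..<N. f (i, \<sigma> i))"
    if "\<sigma> permutes {0..<N}" for \<sigma>
    by (intro prod.cong refl index_mat) (use permutes_in_image[OF that] in auto)
  then show ?thesis
    by (simp add: det_def'[of _ N])
qed

text \<open>Restoring the order of the rows of the second determinant costs the sign of \<sigma>,
  and these signs turn the remaining products into the Leibniz formula for the first one.\<close>

lemma sum_permutations_det:
  fixes c v :: "nat \<Rightarrow> nat \<Rightarrow> 'a::comm_ring_1"
  shows "(\<Sum>\<sigma> | \<sigma> permutes {0..<N}. (\<Prod>j = 0..<N. c j (\<sigma> j)) * det (mat N N (\<lambda>(j, i). v (\<sigma> j) i)))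
    = det (mat N N (\<lambda>(j, k). c j k)) * det (mat N N (\<lambda>(k, i). v k i))"
proof -
  let ?v = "mat N N (\<lambda>(k, i). v k i)"
  have "(\<Prod>j = 0..<N. c j (\<sigma> j)) * det (mat N N (\<lambda>(j, i). v (\<sigma> j) i))
      = (signof \<sigma> * (\<Prod>j = 0..<N. c j (\<sigma> j))) * det ?v" if p: "\<sigma> permutes {0..<N}" for \<sigma>
  proof -
    have "mat N N (\<lambda>(j, i). v (\<sigma> j) i) = mat N N (\<lambda>(i, j). ?v $$ (\<sigma> i, j))"
      using permutes_in_image[OF p] by (intro eq_matI) auto
    moreover have "det (mat N N (\<lambda>(i, j). ?v $$ (\<sigma> i, j))) = signof \<sigma> * det ?v"
      by (rule det_permute_rows) (use p in auto)
    ultimately show ?thesis by simp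
  qed
  then show ?thesis
    by (simp add: det_mat_eq[of N "\<lambda>(j, k). c j k"] sum_distrib_right)
qed

lemma has_sum_sum_finite:
  fixes f :: "'a \<Rightarrow> 'b \<Rightarrow> 'c::topological_comm_monoid_add"
  assumes "finite A" "\<And>a. a \<in> A \<Longrightarrow> (f a has_sum S a) B"
  shows "((\<lambda>x. \<Sum>a\<in>A. f a x) has_sum (\<Sum>a\<in>A. S a)) B"
  using assms by (induction A) (auto intro: has_sum_add)

text \<open>Multiplying out the Leibniz formula gives a sum over all tuples \<mu> of column indices.
  At fixed \<mu> the sum over permutations is again a determinant, with rows
  \<open>u (\<mu> j)\<close>; it vanishes if an index repeats. The injective tuples are then grouped
  by their decreasing rearrangement \<nu>, and each finite group is a product of two
  determinants.\<close>

lemma infinite_Cauchy_Binet: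
  fixes b u :: "nat \<Rightarrow> nat \<Rightarrow> complex"
  assumes summable: "\<And>j i. j < N \<Longrightarrow> i < N \<Longrightarrow> (\<lambda>m. b j m * u m i) abs_summable_on UNIV"
  shows "((\<lambda>\<nu>. det (mat N N (\<lambda>(j, k). b j (\<nu> k))) * det (mat N N (\<lambda>(k, i). u (\<nu> k) i)))
    has_sum det (mat N N (\<lambda>(j, i). \<Sum>\<^sub>\<infinity>m. b j m * u m i))) (decreasing_tuples N)"
proof -
  let ?P = "{\<sigma>. \<sigma> permutes {0..<N}}"
  define g where "g \<mu> = (\<Prod>j = 0..<N. b j (\<mu> j)) * det (mat N N (\<lambda>(j, i). u (\<mu> j) i))" for \<mu>
  let ?S = "det (mat N N (\<lambda>(j, i). \<Sum>\<^sub>\<infinity>m. b j m * u m i))"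
  have "((\<lambda>\<mu>. \<Sum>\<sigma>\<in>?P. signof \<sigma> * (\<Prod>j = 0..<N. b j (\<mu> j) * u (\<mu> j) (\<sigma> j)))
     has_sum (\<Sum>\<sigma>\<in>?P. signof \<sigma> * (\<Prod>j = 0..<N. \<Sum>\<^sub>\<infinity>m. b j m * u m (\<sigma> j)))) ({0..<N} \<rightarrow>\<^sub>E UNIV)"
  proof (intro has_sum_sum_finite has_sum_cmult_right has_sum_prod_PiE summable)
    fix \<sigma> j assume "\<sigma> \<in> ?P" "j \<in> {0..<N}"
    then show "\<sigma> j < N" using permutes_in_image[of \<sigma> "{0..<N}" j] by simp
  qed (auto simp: finite_permutations)
  moreover have g_eq: "g = (\<lambda>\<mu>. \<Sum>\<sigma>\<in>?P. signof \<sigma> * (\<Prod>j = 0..<N. b j (\<mu> j) * u (\<mu> j) (\<sigma> j)))"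
    by (rule ext) (simp add: g_def det_mat_eq sum_distrib_left prod.distrib mult_ac)
  ultimately have "(g has_sum ?S) ({0..<N} \<rightarrow>\<^sub>E UNIV)"
    unfolding g_eq det_mat_eq prod.case by simp
  moreover have "g \<mu> = 0" if not_inj: "\<not> inj_on \<mu> {0..<N}" for \<mu>
  proof -
    obtain i j where ij: "i < N" "j < N" "i \<noteq> j" "\<mu> i = \<mu> j"
      using not_inj unfolding inj_on_def by auto
    have "det (mat N N (\<lambda>(j, i). u (\<mu> j) i)) = 0"
      by (rule det_identical_rows[of _ N i j]) (use ij in \<open>auto simp: row_def\<close>)
    then show ?thesis by (simp add: g_def)
  qed
  ultimately have "(g has_sum ?S) {\<mu> \<in> {0..<N} \<rightarrow>\<^sub>E UNIV. inj_on \<mu> {0..<N}}"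
    by (elim has_sum_cong_neutral[THEN iffD1, rotated -1]) auto
  then have "((\<lambda>p. g ((\<lambda>(\<nu>, \<sigma>). restrict (\<nu> \<circ> \<sigma>) {0..<N}) p)) has_sum ?S)
      (decreasing_tuples N \<times> ?P)"
    by (simp only: has_sum_reindex_bij_betw[OF bij_betw_decreasing_tuples_permutations])
  moreover define h where "h \<nu> \<sigma> = g (restrict (\<nu> \<circ> \<sigma>) {0..<N})" for \<nu> \<sigma> :: "nat \<Rightarrow> nat"
  moreover define r where
    "r \<nu> = det (mat N N (\<lambda>(j, k). b j (\<nu> k))) * det (mat N N (\<lambda>(k, i). u (\<nu> k) i))" for \<nu> :: "nat \<Rightarrow> nat"
  ultimately have "((\<lambda>(\<nu>, \<sigma>). h \<nu> \<sigma>) has_sum ?S) (decreasing_tuples N \<times> ?P)"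
    by (simp only: case_prod_unfold)
  moreover have "(h \<nu> has_sum r \<nu>) ?P" for \<nu>
  proof -
    define c where "c j k = b j (\<nu> k)" for j k
    define v where "v k = u (\<nu> k)" for k
    have "h \<nu> \<sigma> = (\<Prod>j = 0..<N. c j (\<sigma> j)) * det (mat N N (\<lambda>(j, i). v (\<sigma> j) i))" for \<sigma>
      unfolding h_def g_def c_def v_def
      by (intro arg_cong2[where f = "(*)"] prod.cong arg_cong[where f = det] eq_matI) auto
    moreover have "r \<nu> = det (mat N N (\<lambda>(j, k). c j k)) * det (mat N N (\<lambda>(k, i). v k i))"
      by (simp only: r_def c_def v_def)
    ultimately show ?thesis
      by (intro has_sum_finiteI) (simp_all add: sum_permutations_det finite_permutations)
  qed
  ultimately have "(r has_sum ?S) (decreasing_tuples N)"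
    using has_sum_Sigma'[where f = "\<lambda>(\<nu>, \<sigma>). h \<nu> \<sigma>" and B = "\<lambda>_. ?P"
        and A = "decreasing_tuples N" and a = ?S and b = r] by simp
  then show ?thesis
    by (simp only: r_def[abs_def])
qed

section \<open>The generating function of the modified Bessel functions\<close>

lemma abs_summable_Times_mult:
  fixes f g :: "_ \<Rightarrow> complex"
  assumes "f abs_summable_on A" "g abs_summable_on B"
  shows "(\<lambda>(a, b). f a * g b) abs_summable_on A \<times> B"
  unfolding abs_summable_on_Sigma_iff
proof (intro conjI ballI)
  fix a assume "a \<in> A"
  show "(\<lambda>b. (\<lambda>(a, b). f a * g b) (a, b)) abs_summable_on B"
    unfolding prod.case norm_mult using assms(2) by (rule summable_on_cmult_right)
next
  let ?I = "\<Sum>\<^sub>\<infinity>b\<in>B. norm (g b)"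
  have "(\<Sum>\<^sub>\<infinity>b\<in>B. norm ((\<lambda>(a, b). f a * g b) (a, b))) = norm (f a) * ?I" for a
    unfolding prod.case norm_mult by (rule infsum_cmult_right')
  moreover have "0 \<le> ?I"
    by (rule infsum_nonneg) simp
  moreover have "(\<lambda>a. norm (f a) * ?I) summable_on A"
    using assms(1) by (rule summable_on_cmult_left)
  ultimately show "(\<lambda>a. \<Sum>\<^sub>\<infinity>b\<in>B. norm ((\<lambda>(a, b). f a * g b) (a, b))) abs_summable_on A"
    by (simp only: norm_mult real_norm_def abs_mult abs_of_nonneg abs_norm_cancel)
qed

lemma has_sum_Times_mult:
  fixes f g :: "_ \<Rightarrow> complex"
  assumes f: "f abs_summable_on A" "(f has_sum S) A" and g: "g abs_summable_on B" "(g has_sum T) B"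
  shows "((\<lambda>(a, b). f a * g b) has_sum S * T) (A \<times> B)"
proof -
  let ?h = "\<lambda>(a, b). f a * g b"
  have h: "(?h has_sum infsum ?h (A \<times> B)) (A \<times> B)"
    by (rule has_sum_infsum[OF abs_summable_summable[OF abs_summable_Times_mult[OF f(1) g(1)]]])
  have "((\<lambda>a. f a * T) has_sum infsum ?h (A \<times> B)) A"
    by (rule has_sum_Sigma'[OF h]) (simp add: has_sum_cmult_right g(2))
  moreover have "((\<lambda>a. f a * T) has_sum S * T) A"
    by (rule has_sum_cmult_left[OF f(2)])
  ultimately have "infsum ?h (A \<times> B) = S * T"
    by (rule has_sum_unique)
  with h show ?thesis by simp
qed

lemma exp_abs_summable:
  fixes z :: complex
  shows "(\<lambda>n. z ^ n / fact n) abs_summable_on UNIV"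
  using summable_norm_exp[of z]
  by (intro norm_summable_imp_summable_on) (simp add: scaleR_conv_of_real divide_inverse mult.commute)

lemma exp_has_sum:
  fixes z :: complex
  shows "((\<lambda>n. z ^ n / fact n) has_sum exp z) UNIV"
proof (rule norm_summable_imp_has_sum)
  show "summable (\<lambda>n. norm (z ^ n / fact n))"
    using summable_norm_exp[of z] by (simp add: scaleR_conv_of_real divide_inverse mult.commute)
  show "(\<lambda>n. z ^ n / fact n) sums exp z"
    using exp_converges[of z] by (simp add: scaleR_conv_of_real divide_inverse mult.commute)
qed

text \<open>Groups the exponents (a, b) in exp(x t) exp(x / t) by their difference m = a - b, with p
  the smaller exponent. Since \<open>nat m\<close> and \<open>nat (- m)\<close> are the positive and
  negative parts of m, one formula covers both signs.\<close>

lemma bij_betw_int_nat_pairs: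
  "bij_betw (\<lambda>(m, p). (p + nat m, p + nat (- m))) (UNIV \<times> UNIV) (UNIV \<times> UNIV)"
  by (rule bij_betwI[where g = "\<lambda>(a, b). (int a - int b, min a b)"]) (auto simp: min_def)

text \<open>One term of the series for \<open>bessel_I m (2 * x)\<close>, times t^m; the argument 2
  x cancels the halving in that series.\<close>

definition bessel_term :: "complex \<Rightarrow> complex \<Rightarrow> int \<Rightarrow> nat \<Rightarrow> complex" where
  "bessel_term x t m p = x ^ (2 * p + nat \<bar>m\<bar>) / (fact p * fact (p + nat \<bar>m\<bar>)) * t powi m"

lemma bessel_term_eq:
  assumes "t \<noteq> 0"
  shows "bessel_term x t m p =
    (x * t) ^ (p + nat m) / fact (p + nat m) * ((x / t) ^ (p + nat (- m)) / fact (p + nat (- m)))"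
proof -
  \<comment> \<open>The p pairs of factors x t and x / t lose their t; only the |m| surplus factors
    of one kind keep it.\<close>
  have sq: "(x * t) ^ p * (x / t) ^ p = x ^ (2 * p)"
    using assms by (simp add: power_mult_distrib[symmetric] power_mult power2_eq_square)
  show ?thesis
  proof (cases "m \<ge> 0")
    case True
    then obtain n where m: "m = int n" using nonneg_int_cases by blast
    have "(x * t) ^ (p + n) * (x / t) ^ p = ((x * t) ^ p * (x / t) ^ p) * (x * t) ^ n"
      by (simp add: power_add)
    also have "\<dots> = x ^ (2 * p + n) * t ^ n"
      unfolding sq by (simp add: power_add power_mult_distrib)
    finally show ?thesis
      by (simp add: bessel_term_def m mult.commute)
  next
    case False
    then obtain n where m: "m = - int n" using False by (intro that[of "nat (- m)"]) simp
    have "(x * t) ^ p * (x / t) ^ (p + n) = ((x * t) ^ p * (x / t) ^ p) * (x / t) ^ n"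
      by (simp add: power_add)
    also have "\<dots> = x ^ (2 * p + n) / t ^ n"
      unfolding sq by (simp add: power_add power_divide)
    finally have e: "(x * t) ^ p * (x / t) ^ (p + n) = x ^ (2 * p + n) / t ^ n" .
    have "bessel_term x t m p = (x ^ (2 * p + n) / t ^ n) / (fact p * fact (p + n))"
      by (simp add: bessel_term_def m power_int_minus divide_inverse mult_ac)
    also have "\<dots> = (x * t) ^ p / fact p * ((x / t) ^ (p + n) / fact (p + n))"
      by (simp only: e[symmetric] times_divide_times_eq)
    finally show ?thesis
      by (simp add: m)
  qed
qed

lemma
  assumes "t \<noteq> 0"
  shows bessel_term_abs_summable: "(\<lambda>(m, p). bessel_term x t m p) abs_summable_on UNIV \<times> UNIV"
    and bessel_term_has_sum: "((\<lambda>(m, p). bessel_term x t m p) has_sum exp (x * (t + 1 / t))) (UNIV \<times> UNIV)"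
proof -
  let ?h = "\<lambda>(a, b). (x * t) ^ a / fact a * ((x / t) ^ b / fact b)"
  let ?j = "\<lambda>(m, p). (p + nat m, p + nat (- m))"
  have eq: "(\<lambda>(m, p). bessel_term x t m p) = (\<lambda>mp. ?h (?j mp))"
    by (rule ext) (simp add: bessel_term_eq[OF assms] split: prod.split)
  have "?h abs_summable_on UNIV \<times> UNIV"
    by (intro abs_summable_Times_mult exp_abs_summable)
  then show "(\<lambda>(m, p). bessel_term x t m p) abs_summable_on UNIV \<times> UNIV"
    unfolding eq by (rule summable_on_reindex_bij_betw[OF bij_betw_int_nat_pairs, THEN iffD2])
  have "(?h has_sum exp (x * t) * exp (x / t)) (UNIV \<times> UNIV)"
    by (intro has_sum_Times_mult exp_abs_summable exp_has_sum)
  also have "exp (x * t) * exp (x / t) = exp (x * (t + 1 / t))"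
    by (simp add: exp_add[symmetric] algebra_simps)
  finally show "((\<lambda>(m, p). bessel_term x t m p) has_sum exp (x * (t + 1 / t))) (UNIV \<times> UNIV)"
    unfolding eq by (rule has_sum_reindex_bij_betw[OF bij_betw_int_nat_pairs, THEN iffD2])
qed

lemma bessel_term_has_sum_bessel_I:
  assumes "t \<noteq> 0"
  shows "(bessel_term x t m has_sum bessel_I m (2 * x) * t powi m) UNIV"
    and "bessel_term x t m abs_summable_on UNIV"
proof -
  have abs: "bessel_term x t' m abs_summable_on UNIV" if "t' \<noteq> 0" for t'
    using bessel_term_abs_summable[OF that, of x] unfolding abs_summable_on_Sigma_iff by simp
  then show "bessel_term x t m abs_summable_on UNIV"
    using assms .
  \<comment> \<open>At t = 1 the terms are those of the Bessel series alone, so the unconditional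
    sum can be compared with the ordered series defining \<open>bessel_I\<close>.\<close>
  have "(bessel_term x 1 m has_sum infsum (bessel_term x 1 m) UNIV) UNIV"
    by (rule has_sum_infsum[OF abs_summable_summable[OF abs]]) simp
  moreover from sums_unique[OF has_sum_imp_sums[OF this]]
  have "bessel_I m (2 * x) = infsum (bessel_term x 1 m) UNIV"
    by (simp add: bessel_term_def[abs_def] bessel_I_def)
  ultimately have "((\<lambda>p. bessel_term x 1 m p * t powi m) has_sum bessel_I m (2 * x) * t powi m) UNIV"
    by (intro has_sum_cmult_left) simp
  then show "(bessel_term x t m has_sum bessel_I m (2 * x) * t powi m) UNIV"
    by (simp add: bessel_term_def[abs_def])
qed

lemma bessel_I_generating_function:
  assumes "t \<noteq> 0"
  shows "((\<lambda>m. bessel_I m (2 * x) * t powi m) has_sum exp (x * (t + 1 / t))) UNIV"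
  using bessel_term_has_sum[OF assms, of x]
  by (rule has_sum_Sigma') (simp add: bessel_term_has_sum_bessel_I[OF assms])

lemma bessel_I_powi_abs_summable:
  assumes "t \<noteq> 0"
  shows "(\<lambda>m. bessel_I m (2 * x) * t powi m) abs_summable_on UNIV"
proof -
  have "(\<lambda>m. \<Sum>\<^sub>\<infinity>p. norm (bessel_term x t m p)) abs_summable_on UNIV"
    using bessel_term_abs_summable[OF assms, of x] unfolding abs_summable_on_Sigma_iff prod.case by (rule conjunct2)
  then show ?thesis
  proof (rule abs_summable_on_comparison_test)
    fix m :: int
    have "bessel_I m (2 * x) * t powi m = infsum (bessel_term x t m) UNIV"
      by (rule infsumI[OF bessel_term_has_sum_bessel_I(1)[OF assms], symmetric])
    then show "norm (bessel_I m (2 * x) * t powi m) \<le> norm (\<Sum>\<^sub>\<infinity>p. norm (bessel_term x t m p))"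
      unfolding real_norm_def
      by (simp only: order_trans[OF norm_infsum_bound[OF bessel_term_has_sum_bessel_I(2)[OF assms]] abs_ge_self])
  qed
qed

text \<open>The decay of the Bessel functions is read off from their generating function: K^|m| is
  at most K^m + K^(-m), so convergence at t = K and at t = 1 / K suffices.\<close>

lemma bessel_I_power_abs_summable:
  assumes "K \<ge> 1"
  shows "(\<lambda>m. norm (bessel_I m (2 * x)) * K ^ nat \<bar>m\<bar>) summable_on UNIV"
proof -
  have K: "complex_of_real K \<noteq> 0" "complex_of_real (1 / K) \<noteq> 0" using assms by auto
  have "(\<lambda>m. norm (bessel_I m (2 * x) * of_real K powi m)
      + norm (bessel_I m (2 * x) * of_real (1 / K) powi m)) summable_on UNIV"
    by (intro summable_on_add bessel_I_powi_abs_summable K)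
  then have "(\<lambda>m. norm (norm (bessel_I m (2 * x)) * K ^ nat \<bar>m\<bar>)) summable_on UNIV"
  proof (rule abs_summable_on_comparison_test')
    fix m :: int
    have "K ^ nat \<bar>m\<bar> \<le> K powi m + (1 / K) powi m"
    proof (cases "m \<ge> 0")
      case True
      then show ?thesis using assms by (simp add: power_int_def)
    next
      case False
      then show ?thesis using assms by (simp add: power_int_def field_simps)
    qed
    then have "norm (bessel_I m (2 * x)) * K ^ nat \<bar>m\<bar>
        \<le> norm (bessel_I m (2 * x)) * (K powi m + (1 / K) powi m)"
      by (rule mult_left_mono) simp
    then show "norm (norm (bessel_I m (2 * x)) * K ^ nat \<bar>m\<bar>) \<le> norm (bessel_I m (2 * x) * of_real K powi m)
      + norm (bessel_I m (2 * x) * of_real (1 / K) powi m)"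
      using assms by (simp add: norm_mult norm_power_int distrib_left norm_divide)
  qed
  then show ?thesis using assms by (simp add: norm_mult abs_mult)
qed

section \<open>Chebyshev polynomials of a bidiagonal matrix\<close>

text \<open>Entry \<open>(i, j)\<close> of the polynomial with \<open>t + 1/t \<mapsto> t^m + t^-m\<close>, evaluated at the upper
  bidiagonal matrix with diagonal \<open>z\<close> and superdiagonal 1.  The matrix is kept infinite: being upper
  triangular, it restricts to every leading block.\<close>

fun cheb :: "(nat \<Rightarrow> complex) \<Rightarrow> nat \<Rightarrow> nat \<Rightarrow> nat \<Rightarrow> complex" where
  "cheb z 0 i j = (if i = j then 2 else 0)"
| "cheb z (Suc 0) i j = (if i = j then z i else if Suc i = j then 1 else 0)"
| "cheb z (Suc (Suc m)) i j = z i * cheb z (Suc m) i j + cheb z (Suc m) (Suc i) j - cheb z m i j"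

text \<open>The even extension in m, as t^m + t^-m suggests; recurrence and product formula then
  hold for all integers without case distinctions.\<close>

definition chebi :: "(nat \<Rightarrow> complex) \<Rightarrow> int \<Rightarrow> nat \<Rightarrow> nat \<Rightarrow> complex" where
  "chebi z m i j = cheb z (nat \<bar>m\<bar>) i j"

lemma chebi_minus [simp]: "chebi z (- m) i j = chebi z m i j"
  by (simp add: chebi_def)

lemma chebi_of_nat [simp]: "chebi z (int m) i j = cheb z m i j"
  by (simp add: chebi_def)

text \<open>Multiplication by t + 1/t, read as multiplication by the bidiagonal matrix. At m = 0
  both terms on the left coincide, which fits because the polynomial for m = 0 is 2 and not
  1.\<close>

lemma chebi_recurrence:
  "chebi z (m + 1) i j + chebi z (m - 1) i j = z i * chebi z m i j + chebi z m (Suc i) j"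
proof -
  have nat: "chebi z (int n + 1) i j + chebi z (int n - 1) i j
      = z i * chebi z (int n) i j + chebi z (int n) (Suc i) j" for n
  proof (cases n)
    case 0
    then show ?thesis by (simp add: chebi_def)
  next
    case (Suc k)
    have "nat \<bar>2 + int k\<bar> = Suc (Suc k)" "nat \<bar>1 + int k\<bar> = Suc k" by simp_all
    then show ?thesis using Suc by (simp add: chebi_def)
  qed
  show ?thesis
  proof (cases "m \<ge> 0")
    case True
    then show ?thesis using nat[of "nat m"] by simp
  next
    case False
    have "chebi z (m + 1) i j = chebi z (- m - 1) i j" "chebi z (m - 1) i j = chebi z (- m + 1) i j"
      using chebi_minus[of z "m + 1" i j] chebi_minus[of z "m - 1" i j] by simp_all
    then show ?thesis using nat[of "nat (- m)"] False by (simp add: add.commute)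
  qed
qed

lemma cheb_eq_0_lower: "j < i \<Longrightarrow> cheb z m i j = 0"
  by (induction z m i j rule: cheb.induct) auto

lemma cheb_eq_0_upper: "i + m < j \<Longrightarrow> cheb z m i j = 0"
  by (induction z m i j rule: cheb.induct) auto

text \<open>The m-th superdiagonal is reached only by the leading power of the matrix, as a product
  of m superdiagonal ones. The case m = 0 would give 2.\<close>

lemma cheb_band: "m > 0 \<Longrightarrow> cheb z m i (i + m) = 1"
proof (induction m arbitrary: i rule: less_induct)
  case (less m)
  consider "m = 1" | k where "m = Suc (Suc k)"
    using less.prems by (metis One_nat_def Suc_pred gr0_conv_Suc neq0_conv)
  then show ?case
  proof cases
    case 2
    have "cheb z (Suc k) (Suc i) (Suc i + Suc k) = 1"
      by (rule less.IH) (use 2 in auto)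
    then show ?thesis
      using 2 by (simp add: cheb_eq_0_upper)
  qed simp
qed

lemma cheb_diag:
  assumes "z i = w + inverse w" "w \<noteq> 0"
  shows "cheb z m i i = w ^ m + inverse w ^ m"
  using assms(1)
proof (induction z m i i rule: cheb.induct)
  case (3 z m i)
  have inv: "w * (inverse w * c) = c" for c
    using assms(2) by (simp add: mult.assoc[symmetric])
  from 3 show ?case
    by (simp add: cheb_eq_0_lower algebra_simps inv)
qed auto

text \<open>The base K = B + 2 satisfies (B + 1) K + 1 \<le> K^2, so it absorbs the three terms of
  the recurrence; the factor 2 is the entry at m = 0.\<close>

lemma norm_cheb_le:
  assumes "\<And>i. norm (z i) \<le> B"
  shows "norm (cheb z m i j) \<le> 2 * (B + 2) ^ m"
proof -
  have B: "B \<ge> 0" using assms[of 0] norm_ge_zero order_trans by blast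
  show ?thesis
    using assms
  proof (induction z m i j rule: cheb.induct)
    case (2 z i j)
    have "norm (z j) \<le> 2 * B + 4" using 2[of j] B by linarith
    then show ?case using B by auto
  next
    case (3 z m i j)
    let ?K = "B + 2"
    have "norm (cheb z (Suc (Suc m)) i j)
        \<le> norm (z i) * norm (cheb z (Suc m) i j) + norm (cheb z (Suc m) (Suc i) j) + norm (cheb z m i j)"
      unfolding cheb.simps(3) norm_mult[symmetric]
      by (intro order_trans[OF norm_triangle_ineq4] add_right_mono norm_triangle_ineq)
    also have "\<dots> \<le> B * (2 * ?K ^ Suc m) + 2 * ?K ^ Suc m + 2 * ?K ^ m"
      using 3 B by (intro add_mono mult_mono) auto
    also have "\<dots> = 2 * ?K ^ m * ((B + 1) * ?K + 1)"
      by (simp add: algebra_simps)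
    also have "\<dots> \<le> 2 * ?K ^ m * (?K * ?K)"
      using B by (intro mult_left_mono) (auto simp: algebra_simps)
    finally show ?case by (simp add: algebra_simps)
  qed auto
qed

text \<open>The truncated sum is the full matrix product, since by triangularity column j < N has no
  entries in rows from N on. The induction follows the recurrence in k, with i arbitrary because the
  recurrence passes to row i + 1; m is an integer because m - k may be negative.\<close>

lemma cheb_product:
  assumes "j < N"
  shows "(\<Sum>l<N. cheb z k i l * chebi z m l j) = chebi z (m + int k) i j + chebi z (m - int k) i j"
proof (induction k arbitrary: i rule: less_induct)
  case (less k)
  have beyond: "chebi z m i j = 0" if "N \<le> i" for i m
    using assms that by (simp add: chebi_def cheb_eq_0_lower)
  consider "k = 0" | "k = 1" | r where "k = Suc (Suc r)"
    by (metis One_nat_def not0_implies_Suc)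
  then show ?case
  proof cases
    case 1
    have "(\<Sum>l<N. cheb z k i l * chebi z m l j) = (\<Sum>l<N. if i = l then 2 * chebi z m l j else 0)"
      using 1 by (intro sum.cong) auto
    then show ?thesis using 1 beyond by (auto simp: sum.delta)
  next
    case 2
    have "(\<Sum>l<N. cheb z k i l * chebi z m l j)
        = (\<Sum>l<N. (if i = l then z i * chebi z m l j else 0) + (if Suc i = l then chebi z m l j else 0))"
      using 2 by (intro sum.cong) auto
    also have "\<dots> = z i * chebi z m i j + chebi z m (Suc i) j"
      using beyond by (auto simp: sum.distrib sum.delta)
    finally show ?thesis using 2 chebi_recurrence[of z m i j] by simp
  next
    case (3 r)
    have IH1: "(\<Sum>l<N. cheb z (Suc r) i l * chebi z m l j)
        = chebi z (m + int r + 1) i j + chebi z (m - int r - 1) i j" for i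
      using less.IH[of "Suc r" i] 3 by (simp add: algebra_simps)
    have IH0: "(\<Sum>l<N. cheb z r i l * chebi z m l j) = chebi z (m + int r) i j + chebi z (m - int r) i j"
      using less.IH[of r i] 3 by simp
    have "(\<Sum>l<N. cheb z k i l * chebi z m l j) = z i * (\<Sum>l<N. cheb z (Suc r) i l * chebi z m l j)
        + (\<Sum>l<N. cheb z (Suc r) (Suc i) l * chebi z m l j) - (\<Sum>l<N. cheb z r i l * chebi z m l j)"
      by (simp only: 3 cheb.simps left_diff_distrib distrib_right sum_subtractf sum.distrib
          sum_distrib_left mult.assoc)
    also have "\<dots> = (z i * chebi z (m + int r + 1) i j + chebi z (m + int r + 1) (Suc i) j)
        + (z i * chebi z (m - int r - 1) i j + chebi z (m - int r - 1) (Suc i) j)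
        - chebi z (m + int r) i j - chebi z (m - int r) i j"
      unfolding IH1 IH0 by (simp add: algebra_simps)
    also have "\<dots> = chebi z (m + int r + 2) i j + chebi z (m - int r - 2) i j"
      using chebi_recurrence[of z "m + int r + 1" i j] chebi_recurrence[of z "m - int r - 1" i j]
      by (simp add: algebra_simps)
    finally show ?thesis using 3 by (simp add: algebra_simps)
  qed
qed

lemma chebi_product:
  assumes "j < N"
  shows "(\<Sum>l<N. chebi z k i l * chebi z m l j) = chebi z (m + k) i j + chebi z (m - k) i j"
  using cheb_product[OF assms, of z "nat \<bar>k\<bar>" i m] by (cases "k \<ge> 0") (simp_all add: chebi_def add.commute)

section \<open>The exponential of the bidiagonal matrix\<close>

lemma bessel_I_minus [simp]: "bessel_I (- m) y = bessel_I m y"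
  by (simp add: bessel_I_def)

lemma bessel_I_chebi_abs_summable:
  assumes bdd: "\<And>i. norm (z i) \<le> B"
  shows "(\<lambda>m. bessel_I m (2 * x) * chebi z (m + k) i j) abs_summable_on UNIV"
proof -
  let ?K = "B + 2"
  have K: "?K \<ge> 1" using bdd[of 0] norm_ge_zero[of "z 0"] by linarith
  have "(\<lambda>m. norm (bessel_I m (2 * x)) * ?K ^ nat \<bar>m\<bar> * (2 * ?K ^ nat \<bar>k\<bar>)) summable_on UNIV"
    by (intro summable_on_cmult_left bessel_I_power_abs_summable K)
  then show ?thesis
  proof (rule abs_summable_on_comparison_test')
    fix m :: int
    have "norm (chebi z (m + k) i j) \<le> 2 * ?K ^ nat \<bar>m + k\<bar>"
      unfolding chebi_def by (rule norm_cheb_le[of z B, OF bdd])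
    also have "?K ^ nat \<bar>m + k\<bar> \<le> ?K ^ (nat \<bar>m\<bar> + nat \<bar>k\<bar>)"
      by (rule power_increasing[OF _ K]) linarith
    finally have "norm (chebi z (m + k) i j) \<le> 2 * (?K ^ nat \<bar>m\<bar> * ?K ^ nat \<bar>k\<bar>)"
      by (simp add: power_add)
    then have "norm (bessel_I m (2 * x)) * norm (chebi z (m + k) i j)
        \<le> norm (bessel_I m (2 * x)) * (2 * (?K ^ nat \<bar>m\<bar> * ?K ^ nat \<bar>k\<bar>))"
      by (rule mult_left_mono) simp
    then show "norm (bessel_I m (2 * x) * chebi z (m + k) i j)
        \<le> norm (bessel_I m (2 * x)) * ?K ^ nat \<bar>m\<bar> * (2 * ?K ^ nat \<bar>k\<bar>)"
      by (simp add: norm_mult mult_ac)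
  qed
qed

lemma bij_betw_int_shift: "bij_betw (\<lambda>m::int. m + k) UNIV UNIV"
  by (rule bij_betwI[where g = "\<lambda>m. m - k"]) auto

text \<open>Translating m by k moves the shift from the matrix polynomial to the Bessel
  index.\<close>

lemma bessel_I_shift_chebi:
  assumes bdd: "\<And>i. norm (z i) \<le> B"
  shows "(\<lambda>m. bessel_I (m - k) (2 * x) * chebi z m i j) abs_summable_on UNIV"
    and "((\<lambda>m. bessel_I (m - k) (2 * x) * chebi z m i j)
      has_sum (\<Sum>\<^sub>\<infinity>m. bessel_I m (2 * x) * chebi z (m + k) i j)) UNIV"
proof -
  note abs = bessel_I_chebi_abs_summable[of z B, OF bdd, of x k i j]
  show "(\<lambda>m. bessel_I (m - k) (2 * x) * chebi z m i j) abs_summable_on UNIV"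
    using summable_on_reindex_bij_betw[OF bij_betw_int_shift[of k],
        of "\<lambda>m. norm (bessel_I (m - k) (2 * x) * chebi z m i j)"] abs by simp
  show "((\<lambda>m. bessel_I (m - k) (2 * x) * chebi z m i j)
      has_sum (\<Sum>\<^sub>\<infinity>m. bessel_I m (2 * x) * chebi z (m + k) i j)) UNIV"
    using has_sum_reindex_bij_betw[OF bij_betw_int_shift[of k],
        of "\<lambda>m. bessel_I (m - k) (2 * x) * chebi z m i j"]
      has_sum_infsum[OF abs_summable_summable[OF abs]] by simp
qed

text \<open>The matrix \<open>exp (x Z)\<close>; the sum runs over all integers, which counts \<open>m\<close> and \<open>- m\<close>
  separately, whence the factor 1/2.\<close>

definition bessel_op :: "complex \<Rightarrow> (nat \<Rightarrow> complex) \<Rightarrow> nat \<Rightarrow> nat \<Rightarrow> complex" where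
  "bessel_op x z i j = (\<Sum>\<^sub>\<infinity>m. bessel_I m (2 * x) * chebi z m i j) / 2"

lemma bessel_op_has_sum:
  assumes bdd: "\<And>i. norm (z i) \<le> B"
  shows "((\<lambda>m. bessel_I m (2 * x) * chebi z m i j / 2) has_sum bessel_op x z i j) UNIV"
  unfolding bessel_op_def divide_inverse
  using bessel_I_shift_chebi(2)[of z B, OF bdd, of 0 x i j] by (intro has_sum_cmult_left) simp

text \<open>The product formula applied under the sum produces the polynomials with indices m + k
  and m - k. Translating the two resulting series separately collects the coefficient of each
  polynomial.\<close>

lemma bessel_op_times_chebi:
  assumes bdd: "\<And>i. norm (z i) \<le> B" and j: "j < N"
  shows "((\<lambda>m. (bessel_I (m - k) (2 * x) + bessel_I (m + k) (2 * x)) * chebi z m i j / 2)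
      has_sum (\<Sum>l<N. bessel_op x z i l * chebi z k l j)) UNIV"
proof -
  let ?I = "\<lambda>m. bessel_I m (2 * x)"
  define S where "S k = (\<Sum>\<^sub>\<infinity>m. ?I m * chebi z (m + k) i j)" for k
  have S: "((\<lambda>m. ?I (m - k) * chebi z m i j) has_sum S k) UNIV"
    "((\<lambda>m. ?I m * chebi z (m + k) i j) has_sum S k) UNIV" for k
    unfolding S_def using bessel_I_shift_chebi(2)[of z B, OF bdd]
      has_sum_infsum[OF abs_summable_summable[OF bessel_I_chebi_abs_summable[of z B, OF bdd]]] by simp_all
  have "((\<lambda>m. \<Sum>l<N. ?I m * chebi z m i l / 2 * chebi z k l j)
      has_sum (\<Sum>l<N. bessel_op x z i l * chebi z k l j)) UNIV"
    by (intro has_sum_sum_finite has_sum_cmult_left bessel_op_has_sum[of z B, OF bdd]) simp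
  moreover have "(\<Sum>l<N. ?I m * chebi z m i l / 2 * chebi z k l j)
      = (?I m * chebi z (m + k) i j + ?I m * chebi z (m + - k) i j) / 2" for m
  proof -
    have "(\<Sum>l<N. ?I m * chebi z m i l / 2 * chebi z k l j)
        = ?I m / 2 * (\<Sum>l<N. chebi z m i l * chebi z k l j)"
      by (simp add: sum_distrib_left mult_ac)
    also have "\<dots> = ?I m / 2 * (chebi z (m + k) i j + chebi z (m + - k) i j)"
      using chebi_product[OF j, of z m i k] chebi_minus[of z "k - m" i j] by (simp add: add.commute)
    finally show ?thesis by (simp add: algebra_simps add_divide_distrib)
  qed
  ultimately have "((\<lambda>m. (?I m * chebi z (m + k) i j + ?I m * chebi z (m + - k) i j) / 2)
      has_sum (\<Sum>l<N. bessel_op x z i l * chebi z k l j)) UNIV"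
    by (simp only:)
  moreover have "((\<lambda>m. (?I m * chebi z (m + k) i j + ?I m * chebi z (m + - k) i j) / 2)
      has_sum (S k + S (- k)) / 2) UNIV"
    unfolding divide_inverse by (intro has_sum_cmult_left has_sum_add S)
  ultimately have eq: "(\<Sum>l<N. bessel_op x z i l * chebi z k l j) = (S k + S (- k)) / 2"
    by (rule has_sum_unique)
  have "((\<lambda>m. (?I (m - k) * chebi z m i j + ?I (m - - k) * chebi z m i j) / 2)
      has_sum (S k + S (- k)) / 2) UNIV"
    unfolding divide_inverse by (intro has_sum_cmult_left has_sum_add S)
  then show ?thesis
    unfolding eq by (simp add: distrib_right)
qed

lemma has_sum_even_int:
  fixes g :: "int \<Rightarrow> 'a::{real_normed_field, uniform_topological_group_add}"
  assumes "(g has_sum S) UNIV" and even: "\<And>m. g (- m) = g m"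
  shows "((\<lambda>n. if n = 0 then g 0 else 2 * g (int n)) has_sum S) UNIV"
proof -
  \<comment> \<open>The fibre of the absolute value over n. At n = 0 it is a singleton, so g 0 is
    counted once.\<close>
  let ?B = "\<lambda>n. {int n, - int n}"
  have "bij_betw snd (Sigma UNIV ?B) UNIV"
    by (rule bij_betwI[where g = "\<lambda>m. (nat \<bar>m\<bar>, m)"]) auto
  from has_sum_reindex_bij_betw[OF this, of g S] assms(1)
  have "((\<lambda>p. g (snd p)) has_sum S) (Sigma UNIV ?B)" by simp
  from this show ?thesis
  proof (rule has_sum_Sigma'[where f = "\<lambda>p. g (snd p)" and B = ?B])
    fix n :: nat
    show "((\<lambda>m. g (snd (n, m))) has_sum (if n = 0 then g 0 else 2 * g (int n))) (?B n)"
      by (rule has_sum_finiteI) (auto simp: even)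
  qed
qed

section \<open>The columns u_m and the coefficients of their images under exp(x Z)\<close>

definition cheb_vec :: "nat \<Rightarrow> (nat \<Rightarrow> complex) \<Rightarrow> nat \<Rightarrow> nat \<Rightarrow> complex" where
  "cheb_vec N z m i = (if m = 0 then of_bool (i = N - 1) else cheb z m i (N - 1))"

text \<open>Row j expands the image of u_k for k = N - 1 - j. The last row has k = 0, and there u_0
  is half the column given by \<open>cheb\<close>; hence the 1/2.\<close>

definition bessel_coeff :: "nat \<Rightarrow> complex \<Rightarrow> nat \<Rightarrow> nat \<Rightarrow> complex" where
  "bessel_coeff N x j m = (if j = N - 1 then 1 / 2 else 1) *
     (bessel_I (int m - int (N - 1 - j)) (2 * x) + bessel_I (int m + int (N - 1 - j)) (2 * x))"

lemma
  assumes bdd: "\<And>i. norm (z i) \<le> B" and "j < N"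
  shows bessel_coeff_abs_summable: "(\<lambda>m. bessel_coeff N x j m * cheb_vec N z m i) abs_summable_on UNIV"
    and bessel_coeff_has_sum: "((\<lambda>m. bessel_coeff N x j m * cheb_vec N z m i)
      has_sum (\<Sum>l<N. bessel_op x z i l * cheb_vec N z (N - 1 - j) l)) UNIV"
proof -
  define k where "k = N - 1 - j"
  define c where "c = (if k = 0 then 1 / 2 else 1 :: complex)"
  define g where "g m = (bessel_I (m - int k) (2 * x) + bessel_I (m + int k) (2 * x)) * chebi z m i (N - 1) / 2"
    for m :: int
  have k0: "k = 0 \<longleftrightarrow> j = N - 1" using assms(2) by (auto simp: k_def)
  have kS: "N - Suc j = k" by (simp add: k_def)
  have even: "g (- m) = g m" for m
  proof -
    have "bessel_I (- m - int k) (2 * x) = bessel_I (m + int k) (2 * x)"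
      "bessel_I (- m + int k) (2 * x) = bessel_I (m - int k) (2 * x)"
      using bessel_I_minus[of "m + int k" "2 * x"] bessel_I_minus[of "m - int k" "2 * x"] by simp_all
    then show ?thesis by (simp add: g_def add.commute)
  qed
  \<comment> \<open>For m > 0 the factor 2 from folding m and -m cancels the division by 2 in g; at
    m = 0 the diagonal entry 2 of \<open>cheb\<close> does.\<close>
  have fold: "bessel_coeff N x j m * cheb_vec N z m i = c * (if m = 0 then g 0 else 2 * g (int m))" for m
    using k0 kS by (auto simp: bessel_coeff_def c_def g_def chebi_def cheb_vec_def)
  have "(g has_sum (\<Sum>l<N. bessel_op x z i l * chebi z (int k) l (N - 1))) UNIV"
    unfolding g_def using bdd by (rule bessel_op_times_chebi) (use assms(2) in auto)
  then have "((\<lambda>m. c * (if m = 0 then g 0 else 2 * g (int m)))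
      has_sum c * (\<Sum>l<N. bessel_op x z i l * chebi z (int k) l (N - 1))) UNIV"
    by (intro has_sum_cmult_right has_sum_even_int even)
  also have "c * (\<Sum>l<N. bessel_op x z i l * chebi z (int k) l (N - 1))
      = (\<Sum>l<N. bessel_op x z i l * cheb_vec N z k l)"
    unfolding sum_distrib_left by (intro sum.cong refl) (simp add: cheb_vec_def c_def)
  finally show "((\<lambda>m. bessel_coeff N x j m * cheb_vec N z m i)
      has_sum (\<Sum>l<N. bessel_op x z i l * cheb_vec N z (N - 1 - j) l)) UNIV"
    by (simp only: fold k_def)
  \<comment> \<open>Absolute convergence is shown over the integers first and folded afterwards, the
    norms of g being even as well.\<close>
  have "(\<lambda>m. norm (bessel_I (m - int k) (2 * x) * chebi z m i (N - 1))
      + norm (bessel_I (m - - int k) (2 * x) * chebi z m i (N - 1))) summable_on UNIV"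
    by (intro summable_on_add bessel_I_shift_chebi(1)[of z B, OF bdd])
  then have "g abs_summable_on UNIV"
  proof (rule abs_summable_on_comparison_test')
    fix m
    have "norm (g m) \<le> norm (bessel_I (m - int k) (2 * x) * chebi z m i (N - 1)
      + bessel_I (m - - int k) (2 * x) * chebi z m i (N - 1))"
      by (simp add: g_def norm_divide distrib_right)
    then show "norm (g m) \<le> norm (bessel_I (m - int k) (2 * x) * chebi z m i (N - 1))
      + norm (bessel_I (m - - int k) (2 * x) * chebi z m i (N - 1))"
      by (rule order_trans[OF _ norm_triangle_ineq])
  qed
  then have "((\<lambda>m. norm (g m)) has_sum infsum (\<lambda>m. norm (g m)) UNIV) UNIV"
    by (rule has_sum_infsum)
  from has_sum_even_int[OF this]
  have "(\<lambda>m. norm c * (if m = 0 then norm (g 0) else 2 * norm (g (int m)))) summable_on UNIV"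
    by (intro summable_on_cmult_right) (auto simp: even summable_on_def)
  moreover have "norm c * (if m = 0 then norm (g 0) else 2 * norm (g (int m)))
      = norm (bessel_coeff N x j m * cheb_vec N z m i)" for m
    unfolding fold by (simp add: norm_mult)
  ultimately show "(\<lambda>m. bessel_coeff N x j m * cheb_vec N z m i) abs_summable_on UNIV"
    by simp
qed

lemma bessel_op_lower: "j < i \<Longrightarrow> bessel_op x z i j = 0"
  by (simp add: bessel_op_def chebi_def cheb_eq_0_lower)

text \<open>The diagonal of the m-th polynomial is w^m + w^-m. The generating functions at w and at
  1/w have the same value, and the halving in \<open>bessel_op\<close> averages them.\<close>

lemma bessel_op_diag:
  assumes "z i = w + inverse w" "w \<noteq> 0"
  shows "bessel_op x z i i = exp (x * z i)"
proof -
  have "chebi z m i i = w powi m + inverse w powi m" for m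
    unfolding chebi_def cheb_diag[of z i w, OF assms] by (simp add: power_int_def power_inverse)
  then have "(\<lambda>m. bessel_I m (2 * x) * chebi z m i i)
      = (\<lambda>m. bessel_I m (2 * x) * w powi m + bessel_I m (2 * x) * inverse w powi m)"
    by (simp add: distrib_left)
  moreover have "((\<lambda>m. bessel_I m (2 * x) * w powi m + bessel_I m (2 * x) * inverse w powi m)
      has_sum exp (x * (w + 1 / w)) + exp (x * (inverse w + 1 / inverse w))) UNIV"
    by (intro has_sum_add bessel_I_generating_function) (use assms(2) in auto)
  ultimately show ?thesis
    unfolding bessel_op_def using assms(1) by (simp add: infsumI inverse_eq_divide add.commute)
qed

text \<open>Each factor Z moves the top entry of the last unit vector up by one place with
  coefficient 1. The halving at m = 0 makes that entry 1 for u_0 too.\<close>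

lemma cheb_vec_triangular:
  assumes "i < N" "j < N"
  shows "i < j \<Longrightarrow> cheb_vec N z (N - Suc j) i = 0" and "cheb_vec N z (N - Suc j) j = 1"
  using assms cheb_eq_0_upper[of i "N - 1 - j" "N - 1" z] cheb_band[of "N - 1 - j" z j]
  by (auto simp: cheb_vec_def)

lemma has_sum_bessel_cheb:
  assumes z: "\<And>i. i < N \<Longrightarrow> \<exists>w. w \<noteq> 0 \<and> z i = w + inverse w" and bdd: "\<And>i. norm (z i) \<le> B"
  shows "((\<lambda>\<nu>. det (mat N N (\<lambda>(j, k). bessel_coeff N x j (\<nu> k)))
        * det (mat N N (\<lambda>(k, i). cheb_vec N z (\<nu> k) i)))
    has_sum exp (x * (\<Sum>i<N. z i))) (decreasing_tuples N)"
proof -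
  let ?A = "mat N N (\<lambda>(j, l). cheb_vec N z (N - 1 - j) l)"
  \<comment> \<open>Rows correspond to the vectors here, so the exponential enters transposed and is
    lower triangular.\<close>
  let ?F = "mat N N (\<lambda>(l, i). bessel_op x z i l)"
  have diag: "bessel_op x z i i = exp (x * z i)" if i: "i < N" for i
  proof -
    obtain w where "z i = w + inverse w" "w \<noteq> 0" using z[OF i] by blast
    then show ?thesis by (rule bessel_op_diag[of z i])
  qed
  have "det (mat N N (\<lambda>(j, i). \<Sum>\<^sub>\<infinity>m. bessel_coeff N x j m * cheb_vec N z m i)) = det (?A * ?F)"
  proof (intro arg_cong[where f = det] eq_matI)
    fix j i assume "j < dim_row (?A * ?F)" "i < dim_col (?A * ?F)"
    then have ji: "j < N" "i < N" by auto
    show "mat N N (\<lambda>(j, i). \<Sum>\<^sub>\<infinity>m. bessel_coeff N x j m * cheb_vec N z m i) $$ (j, i) = (?A * ?F) $$ (j, i)"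
      using infsumI[OF bessel_coeff_has_sum[of z B, OF bdd ji(1), of x i]] ji
      by (simp add: scalar_prod_def mult.commute atLeast0LessThan)
  qed auto
  also have "\<dots> = det ?A * det ?F"
    by (rule det_mult) auto
  also have "det ?A = prod_list (diag_mat ?A)"
    by (rule det_upper_triangular) (auto simp: upper_triangular_def cheb_vec_triangular)
  also have "\<dots> = 1"
    by (auto simp: prod_list_diag_prod cheb_vec_triangular)
  also have "det ?F = prod_list (diag_mat ?F)"
    by (rule det_lower_triangular[where n = N]) (auto simp: bessel_op_lower)
  also have "\<dots> = (\<Prod>i<N. exp (x * z i))"
    unfolding prod_list_diag_prod by (simp add: diag atLeast0LessThan)
  also have "\<dots> = exp (x * (\<Sum>i<N. z i))"
    by (simp add: exp_sum sum_distrib_left)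
  finally show ?thesis
    using infinite_Cauchy_Binet[of N "bessel_coeff N x" "cheb_vec N z"] bessel_coeff_abs_summable[of z B, OF bdd]
    by simp
qed

section \<open>Characters as determinants without denominators\<close>

text \<open>A left eigenvector of the bidiagonal matrix for the eigenvalue \<open>z i\<close>.\<close>

definition cheb_eigvec :: "nat \<Rightarrow> (nat \<Rightarrow> complex) \<Rightarrow> nat \<Rightarrow> nat \<Rightarrow> complex" where
  "cheb_eigvec N z i l = (\<Prod>k\<in>{Suc l..<N}. z i - z k)"

lemma cheb_eigvec_eq_0: "l < i \<Longrightarrow> i < N \<Longrightarrow> cheb_eigvec N z i l = 0"
  unfolding cheb_eigvec_def by (rule prod_zero) auto

text \<open>The eigenvector equation paired with v. It amounts to W_l = (z_i - z_(l+1)) W_(l+1),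
  which holds because the product at l has one more factor; \<open>v N = 0\<close> removes the
  boundary term of the truncation.\<close>

lemma cheb_eigvec_adjoint:
  assumes i: "i < N" and v: "v N = 0"
  shows "(\<Sum>l<N. cheb_eigvec N z i l * (z l * v l + v (Suc l))) = z i * (\<Sum>l<N. cheb_eigvec N z i l * v l)"
proof -
  obtain n where n: "N = Suc n" using i by (cases N) auto
  let ?W = "cheb_eigvec N z i"
  have step: "?W l = (z i - z (Suc l)) * ?W (Suc l)" if l: "l < n" for l
    using l unfolding cheb_eigvec_def n by (subst prod.atLeast_Suc_lessThan) auto
  \<comment> \<open>The equation in column 0, which has no superdiagonal entry: the first factor is
    zero for i = 0, the second for i > 0.\<close>
  have first: "(z i - z 0) * ?W 0 = 0"
    using cheb_eigvec_eq_0[of 0 i N z] i by (cases "i = 0") auto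
  have "(\<Sum>l<N. (z i - z l) * ?W l * v l)
      = (z i - z 0) * ?W 0 * v 0 + (\<Sum>l<n. (z i - z (Suc l)) * ?W (Suc l) * v (Suc l))"
    unfolding n by (rule sum.lessThan_Suc_shift)
  also have "\<dots> = (\<Sum>l<n. ?W l * v (Suc l))"
    unfolding first by (simp add: step)
  also have "\<dots> = (\<Sum>l<N. ?W l * v (Suc l))"
    using v by (simp add: n)
  finally have "(\<Sum>l<N. (z i - z l) * ?W l * v l) = (\<Sum>l<N. ?W l * v (Suc l))" .
  then show ?thesis
    by (simp add: algebra_simps sum.distrib sum_subtractf sum_distrib_left)
qed

text \<open>The entries in the character formula: at exponent 0 the Kronecker delta reduces t^0 +
  t^-0 = 2 to 1.\<close>

definition cpow :: "complex \<Rightarrow> nat \<Rightarrow> complex" where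
  "cpow w m = (if m = 0 then 1 else w ^ m + inverse w ^ m)"

text \<open>A left eigenvector turns a polynomial in Z into its value at z_i, and its last entry, an
  empty product, is 1.\<close>

lemma cheb_eigvec_cheb:
  assumes i: "i < N" and z: "z i = w + inverse w" and w: "w \<noteq> 0"
  shows "(\<Sum>l<N. cheb_eigvec N z i l * cheb z m l (N - 1)) = w ^ m + inverse w ^ m"
proof (induction m rule: less_induct)
  case (less m)
  have zero: "cheb z m N (N - 1) = 0" for m
    using i by (intro cheb_eq_0_lower) auto
  have delta: "(\<Sum>l<N. cheb_eigvec N z i l * of_bool (l = N - 1)) = 1"
  proof -
    have "(\<Sum>l<N. cheb_eigvec N z i l * of_bool (l = N - 1))
        = (\<Sum>l<N. if l = N - 1 then cheb_eigvec N z i l else 0)"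
      by (intro sum.cong) auto
    also have "\<dots> = cheb_eigvec N z i (N - 1)"
      using i by simp
    also have "\<dots> = 1" using i by (simp add: cheb_eigvec_def)
    finally show ?thesis .
  qed
  consider "m = 0" | "m = 1" | r where "m = Suc (Suc r)"
    by (metis One_nat_def not0_implies_Suc)
  then show ?case
  proof cases
    case 1
    have "(\<Sum>l<N. cheb_eigvec N z i l * cheb z m l (N - 1))
        = 2 * (\<Sum>l<N. cheb_eigvec N z i l * of_bool (l = N - 1))"
      unfolding sum_distrib_left using 1 by (intro sum.cong) auto
    then show ?thesis using 1 delta by simp
  next
    case 2
    have "(\<Sum>l<N. cheb_eigvec N z i l * cheb z m l (N - 1))
        = (\<Sum>l<N. cheb_eigvec N z i l * (z l * of_bool (l = N - 1) + of_bool (Suc l = N - 1)))"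
      using 2 by (intro sum.cong) auto
    also have "\<dots> = z i * 1"
      using cheb_eigvec_adjoint[OF i, of "\<lambda>l. of_bool (l = N - 1)" z] i delta by simp
    finally show ?thesis using 2 z by simp
  next
    case (3 r)
    have "(\<Sum>l<N. cheb_eigvec N z i l * cheb z m l (N - 1))
        = (\<Sum>l<N. cheb_eigvec N z i l * (z l * cheb z (Suc r) l (N - 1) + cheb z (Suc r) (Suc l) (N - 1)))
          - (\<Sum>l<N. cheb_eigvec N z i l * cheb z r l (N - 1))"
      unfolding 3 cheb.simps sum_subtractf[symmetric] by (simp add: algebra_simps)
    also have "\<dots> = z i * (w ^ Suc r + inverse w ^ Suc r) - (w ^ r + inverse w ^ r)"
      using cheb_eigvec_adjoint[OF i, of "\<lambda>l. cheb z (Suc r) l (N - 1)" z] zero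
        less.IH[of "Suc r"] less.IH[of r] 3 by simp
    also have "\<dots> = w ^ m + inverse w ^ m"
    proof -
      have inv: "w * (inverse w * c) = c" for c
        using w by (simp add: mult.assoc[symmetric])
      show ?thesis unfolding z 3 by (simp add: algebra_simps inv)
    qed
    finally show ?thesis .
  qed
qed

lemma cheb_eigvec_cheb_vec:
  assumes i: "i < N" and z: "z i = w + inverse w" and w: "w \<noteq> 0"
  shows "(\<Sum>l<N. cheb_eigvec N z i l * cheb_vec N z m l) = cpow w m"
proof (cases "m = 0")
  case True
  have "2 * (\<Sum>l<N. cheb_eigvec N z i l * cheb_vec N z m l)
      = (\<Sum>l<N. cheb_eigvec N z i l * cheb z m l (N - 1))"
    unfolding sum_distrib_left using True by (intro sum.cong) (auto simp: cheb_vec_def)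
  then show ?thesis
    using cheb_eigvec_cheb[of i N z w m, OF assms] True by (simp add: cpow_def)
next
  case False
  then show ?thesis
    using cheb_eigvec_cheb[of i N z w m, OF assms] by (simp add: cpow_def cheb_vec_def)
qed

text \<open>Only the second factor depends on the exponents, so the first is common to numerator and
  denominator of the character.\<close>

lemma det_cpow:
  assumes z: "\<And>i. i < N \<Longrightarrow> z i = w i + inverse (w i)" and w: "\<And>i. i < N \<Longrightarrow> w i \<noteq> 0"
  shows "det (mat N N (\<lambda>(i, j). cpow (w i) (\<nu> j)))
    = det (mat N N (\<lambda>(i, l). cheb_eigvec N z i l)) * det (mat N N (\<lambda>(k, l). cheb_vec N z (\<nu> k) l))"
proof -
  let ?W = "mat N N (\<lambda>(i, l). cheb_eigvec N z i l)"
  let ?U = "mat N N (\<lambda>(k, l). cheb_vec N z (\<nu> k) l)"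
  have "mat N N (\<lambda>(i, j). cpow (w i) (\<nu> j)) = ?W * transpose_mat ?U"
  proof (rule eq_matI)
    fix i j assume "i < dim_row (?W * transpose_mat ?U)" "j < dim_col (?W * transpose_mat ?U)"
    then have ij: "i < N" "j < N" by auto
    then show "mat N N (\<lambda>(i, j). cpow (w i) (\<nu> j)) $$ (i, j) = (?W * transpose_mat ?U) $$ (i, j)"
      using cheb_eigvec_cheb_vec[of i N z "w i" "\<nu> j", OF ij(1) z[OF ij(1)] w[OF ij(1)]]
      by (simp add: scalar_prod_def atLeast0LessThan)
  qed auto
  then show ?thesis
    by (simp add: det_mult[of _ N] det_transpose[of _ N])
qed

lemma det_cheb_eigvec:
  "det (mat N N (\<lambda>(i, l). cheb_eigvec N z i l)) = (\<Prod>i<N. \<Prod>k\<in>{Suc i..<N}. z i - z k)"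
proof -
  let ?W = "mat N N (\<lambda>(i, l). cheb_eigvec N z i l)"
  have "det ?W = prod_list (diag_mat ?W)"
    by (rule det_upper_triangular) (auto simp: upper_triangular_def cheb_eigvec_eq_0)
  then show ?thesis
    by (simp add: prod_list_diag_prod cheb_eigvec_def atLeast0LessThan)
qed

text \<open>These are the exponents of the denominator, which therefore equals the eigenvector
  determinant.\<close>

lemma det_cheb_vec_rho:
  "det (mat N N (\<lambda>(k, l). cheb_vec N z (N - Suc k) l)) = 1"
proof -
  let ?U = "mat N N (\<lambda>(k, l). cheb_vec N z (N - Suc k) l)"
  have "det ?U = prod_list (diag_mat ?U)"
    by (rule det_upper_triangular) (auto simp: upper_triangular_def cheb_vec_triangular)
  also have "\<dots> = 1"
    by (auto simp: prod_list_diag_prod cheb_vec_triangular)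
  finally show ?thesis .
qed

definition shifted_weight :: "nat \<Rightarrow> (nat \<Rightarrow> nat) \<Rightarrow> nat \<Rightarrow> nat" where
  "shifted_weight N n = restrict (\<lambda>k. n (Suc k) + (N - Suc k)) {0..<N}"

text \<open>The value 0 beyond N keeps the whole sequence bounded, as the estimates for the infinite
  matrix require.\<close>

definition trace_params :: "nat \<Rightarrow> (nat \<Rightarrow> complex) \<Rightarrow> nat \<Rightarrow> complex" where
  "trace_params N t i = (if i < N then t (Suc i) + inverse (t (Suc i)) else 0)"

text \<open>Rows and columns are interchanged with respect to the character formula, to fit the
  Cauchy-Binet expansion.\<close>

definition char_det :: "nat \<Rightarrow> (nat \<Rightarrow> nat) \<Rightarrow> (nat \<Rightarrow> complex) \<Rightarrow> complex" where
  "char_det N n t = det (mat N N (\<lambda>(k, l). cheb_vec N (trace_params N t) (shifted_weight N n k) l))"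

lemma powi_add_powi_minus:
  "t powi (int a) + t powi (- int a) = t ^ a + inverse t ^ a"
  by (cases "a = 0") (simp_all add: power_int_def power_inverse)

lemma char_denom_eq:
  assumes t: "\<forall>i\<in>{1..N}. t i \<noteq> 0"
  shows "char_denom N t = det (mat N N (\<lambda>(i, l). cheb_eigvec N (trace_params N t) i l))"
proof -
  have "char_denom N t = det (mat N N (\<lambda>(i, j). cpow (t (Suc i)) (N - Suc j)))"
    unfolding char_denom_def det1_def
  proof (intro arg_cong[where f = det] eq_matI)
    fix i j assume "i < dim_row (mat N N (\<lambda>(i, j). cpow (t (Suc i)) (N - Suc j)))"
      "j < dim_col (mat N N (\<lambda>(i, j). cpow (t (Suc i)) (N - Suc j)))"
    then have ij: "i < N" "j < N" by auto
    then have e: "int N - int (j + 1) = int (N - Suc j)" by simp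
    show "mat N N (\<lambda>(i, j). t (i + 1) powi (int N - int (j + 1)) + t (i + 1) powi - (int N - int (j + 1))
        - of_bool (j + 1 = N)) $$ (i, j) = mat N N (\<lambda>(i, j). cpow (t (Suc i)) (N - Suc j)) $$ (i, j)"
      using ij by (simp only: e index_mat prod.case powi_add_powi_minus) (auto simp: cpow_def)
  qed auto
  also have "\<dots> = det (mat N N (\<lambda>(i, l). cheb_eigvec N (trace_params N t) i l))"
    by (subst det_cpow[where z = "trace_params N t"]) (use t in \<open>auto simp: trace_params_def det_cheb_vec_rho\<close>)
  finally show ?thesis .
qed

lemma char_numer_eq:
  assumes t: "\<forall>i\<in>{1..N}. t i \<noteq> 0"
  shows "char_numer N n t = char_denom N t * char_det N n t"
proof -
  have "char_numer N n t = det (mat N N (\<lambda>(i, j). cpow (t (Suc i)) (shifted_weight N n j)))"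
    unfolding char_numer_def det1_def
  proof (intro arg_cong[where f = det] eq_matI)
    fix i j assume "i < dim_row (mat N N (\<lambda>(i, j). cpow (t (Suc i)) (shifted_weight N n j)))"
      "j < dim_col (mat N N (\<lambda>(i, j). cpow (t (Suc i)) (shifted_weight N n j)))"
    then have ij: "i < N" "j < N" by auto
    then have e: "int (n (j + 1)) + int N - int (j + 1) = int (shifted_weight N n j)"
      by (simp add: shifted_weight_def)
    \<comment> \<open>The deltas are nonzero exactly where the exponent vanishes, which is the case
      distinction in \<open>cpow\<close>.\<close>
    have s: "shifted_weight N n j = 0 \<longleftrightarrow> j + 1 = N \<and> n N = 0"
      using ij by (cases "Suc j = N") (auto simp: shifted_weight_def)
    show "mat N N (\<lambda>(i, j). t (i + 1) powi (int (n (j + 1)) + int N - int (j + 1))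
        + t (i + 1) powi - (int (n (j + 1)) + int N - int (j + 1))
        - of_bool (j + 1 = N) * of_bool (n N = 0)) $$ (i, j)
        = mat N N (\<lambda>(i, j). cpow (t (Suc i)) (shifted_weight N n j)) $$ (i, j)"
      using ij by (simp only: e index_mat prod.case powi_add_powi_minus) (use s in \<open>auto simp: cpow_def\<close>)
  qed auto
  also have "\<dots> = det (mat N N (\<lambda>(i, l). cheb_eigvec N (trace_params N t) i l)) * char_det N n t"
    unfolding char_det_def by (rule det_cpow) (use t in \<open>auto simp: trace_params_def\<close>)
  finally show ?thesis by (simp add: char_denom_eq[OF t])
qed

section \<open>Laurent polynomials\<close>

text \<open>Equality is asked only at nonzero arguments, because \<open>powi\<close> turns sums of
  exponents into products only for a nonzero base.\<close>

definition laurent_on :: "nat \<Rightarrow> ((nat \<Rightarrow> complex) \<Rightarrow> complex) \<Rightarrow> bool" where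
  "laurent_on N f \<longleftrightarrow> (\<exists>L. laurent_polynomial N L \<and> (\<forall>t. (\<forall>i\<in>{1..N}. t i \<noteq> 0) \<longrightarrow> f t = L t))"

lemma laurent_polynomial_monomial:
  "laurent_polynomial N (\<lambda>t. c * (\<Prod>i = 1..N. t i powi k i))"
  unfolding laurent_polynomial_def by (intro exI[of _ "{k}"] exI[of _ "\<lambda>_. c"]) simp

lemma laurent_polynomial_add:
  assumes "laurent_polynomial N L" "laurent_polynomial N M"
  shows "laurent_polynomial N (\<lambda>t. L t + M t)"
proof -
  let ?m = "\<lambda>t k. \<Prod>i = 1..N. t i powi k i :: complex"
  obtain K c where K: "finite K" "\<And>t. L t = (\<Sum>k\<in>K. c k * ?m t k)"
    using assms(1) unfolding laurent_polynomial_def by blast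
  obtain J d where J: "finite J" "\<And>t. M t = (\<Sum>k\<in>J. d k * ?m t k)"
    using assms(2) unfolding laurent_polynomial_def by blast
  have "L t + M t = (\<Sum>k\<in>K \<union> J. ((if k \<in> K then c k else 0) + (if k \<in> J then d k else 0)) * ?m t k)" for t
  proof -
    have "L t = (\<Sum>k\<in>K \<union> J. (if k \<in> K then c k else 0) * ?m t k)"
      unfolding K(2) using K(1) J(1) by (intro sum.mono_neutral_cong_left) auto
    moreover have "M t = (\<Sum>k\<in>K \<union> J. (if k \<in> J then d k else 0) * ?m t k)"
      unfolding J(2) using K(1) J(1) by (intro sum.mono_neutral_cong_left) auto
    ultimately show ?thesis by (simp add: distrib_right sum.distrib)
  qed
  then show ?thesis
    unfolding laurent_polynomial_def using K(1) J(1)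
    by (intro exI[of _ "K \<union> J"] exI[of _ "\<lambda>k. (if k \<in> K then c k else 0) + (if k \<in> J then d k else 0)"]) auto
qed

lemma laurent_on_cong:
  assumes "laurent_on N f" "\<And>t. \<forall>i\<in>{1..N}. t i \<noteq> 0 \<Longrightarrow> g t = f t"
  shows "laurent_on N g"
proof -
  obtain L where "laurent_polynomial N L" "\<forall>t. (\<forall>i\<in>{1..N}. t i \<noteq> 0) \<longrightarrow> f t = L t"
    using assms(1) unfolding laurent_on_def by blast
  then show ?thesis
    unfolding laurent_on_def using assms(2) by (intro exI[of _ L]) simp
qed

lemma laurent_on_monomial: "laurent_on N (\<lambda>t. c * (\<Prod>i = 1..N. t i powi k i))"
  unfolding laurent_on_def using laurent_polynomial_monomial by blast

lemma laurent_on_add: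
  assumes "laurent_on N f" "laurent_on N g"
  shows "laurent_on N (\<lambda>t. f t + g t)"
proof -
  obtain L where L: "laurent_polynomial N L" "\<forall>t. (\<forall>i\<in>{1..N}. t i \<noteq> 0) \<longrightarrow> f t = L t"
    using assms(1) unfolding laurent_on_def by blast
  obtain M where M: "laurent_polynomial N M" "\<forall>t. (\<forall>i\<in>{1..N}. t i \<noteq> 0) \<longrightarrow> g t = M t"
    using assms(2) unfolding laurent_on_def by blast
  show ?thesis
    unfolding laurent_on_def using L M
    by (intro exI[of _ "\<lambda>t. L t + M t"] conjI laurent_polynomial_add) simp_all
qed

lemma laurent_on_const: "laurent_on N (\<lambda>t. c)"
  by (rule laurent_on_cong[OF laurent_on_monomial[of N c "\<lambda>_. 0"]]) simp

lemma laurent_on_sum: "(\<And>a. a \<in> A \<Longrightarrow> laurent_on N (f a)) \<Longrightarrow> laurent_on N (\<lambda>t. \<Sum>a\<in>A. f a t)"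
  by (induction A rule: infinite_finite_induct) (auto intro: laurent_on_add laurent_on_const)

lemma laurent_on_monomial_mult:
  assumes "laurent_on N f"
  shows "laurent_on N (\<lambda>t. c * (\<Prod>i = 1..N. t i powi k i) * f t)"
proof -
  obtain L where L: "laurent_polynomial N L" "\<forall>t. (\<forall>i\<in>{1..N}. t i \<noteq> 0) \<longrightarrow> f t = L t"
    using assms unfolding laurent_on_def by blast
  obtain J d where J: "\<And>t. L t = (\<Sum>j\<in>J. d j * (\<Prod>i = 1..N. t i powi j i))"
    using L(1) unfolding laurent_polynomial_def by blast
  have "laurent_on N (\<lambda>t. \<Sum>j\<in>J. c * d j * (\<Prod>i = 1..N. t i powi (k i + j i)))"
    by (intro laurent_on_sum laurent_on_monomial)
  then show ?thesis
  proof (rule laurent_on_cong)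
    fix t :: "nat \<Rightarrow> complex" assume t: "\<forall>i\<in>{1..N}. t i \<noteq> 0"
    have "(\<Prod>i = 1..N. t i powi (k i + j i)) = (\<Prod>i = 1..N. t i powi k i) * (\<Prod>i = 1..N. t i powi j i)" for j
      unfolding prod.distrib[symmetric] using t by (intro prod.cong) (auto simp: power_int_add)
    then show "c * (\<Prod>i = 1..N. t i powi k i) * f t = (\<Sum>j\<in>J. c * d j * (\<Prod>i = 1..N. t i powi (k i + j i)))"
      using L(2) t by (simp add: J sum_distrib_left mult_ac)
  qed
qed

lemma laurent_on_mult:
  assumes "laurent_on N f" "laurent_on N g"
  shows "laurent_on N (\<lambda>t. f t * g t)"
proof -
  obtain L where L: "laurent_polynomial N L" "\<forall>t. (\<forall>i\<in>{1..N}. t i \<noteq> 0) \<longrightarrow> f t = L t"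
    using assms(1) unfolding laurent_on_def by blast
  obtain J d where J: "\<And>t. L t = (\<Sum>j\<in>J. d j * (\<Prod>i = 1..N. t i powi j i))"
    using L(1) unfolding laurent_polynomial_def by blast
  have "laurent_on N (\<lambda>t. \<Sum>j\<in>J. d j * (\<Prod>i = 1..N. t i powi j i) * g t)"
    by (intro laurent_on_sum laurent_on_monomial_mult assms(2))
  then show ?thesis
    by (rule laurent_on_cong) (use L(2) in \<open>simp add: J sum_distrib_right\<close>)
qed

lemma laurent_on_prod: "(\<And>a. a \<in> A \<Longrightarrow> laurent_on N (f a)) \<Longrightarrow> laurent_on N (\<lambda>t. \<Prod>a\<in>A. f a t)"
  by (induction A rule: infinite_finite_induct) (auto intro: laurent_on_mult laurent_on_const)

lemma laurent_on_diff:
  assumes "laurent_on N f" "laurent_on N g"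
  shows "laurent_on N (\<lambda>t. f t - g t)"
  using laurent_on_add[OF assms(1) laurent_on_mult[OF laurent_on_const[of N "-1"] assms(2)]] by simp

lemma laurent_on_power_int:
  assumes "j \<in> {1..N}"
  shows "laurent_on N (\<lambda>t. t j powi m)"
proof (rule laurent_on_cong[OF laurent_on_monomial[of N 1 "\<lambda>i. if i = j then m else 0"]])
  fix t :: "nat \<Rightarrow> complex"
  have "(\<Prod>i = 1..N. t i powi (if i = j then m else 0)) = (\<Prod>i = 1..N. if i = j then t i powi m else 1)"
    by (intro prod.cong) auto
  then show "t j powi m = 1 * (\<Prod>i = 1..N. t i powi (if i = j then m else 0))"
    using assms by (simp add: prod.delta)
qed

lemma laurent_on_trace_params: "laurent_on N (\<lambda>t. trace_params N t i)"
proof (cases "i < N")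
  case True
  then have "laurent_on N (\<lambda>t. t (Suc i) powi 1 + t (Suc i) powi (- 1))"
    by (intro laurent_on_add laurent_on_power_int) auto
  then show ?thesis using True by (simp add: trace_params_def)
qed (simp add: trace_params_def laurent_on_const)

lemma laurent_on_cheb: "laurent_on N (\<lambda>t. cheb (trace_params N t) m i j)"
proof (induction m arbitrary: i rule: less_induct)
  case (less m)
  consider "m = 0" | "m = 1" | r where "m = Suc (Suc r)"
    by (metis One_nat_def not0_implies_Suc)
  then show ?case
  proof cases
    case (3 r)
    then show ?thesis
      by (simp add: laurent_on_diff laurent_on_add laurent_on_mult laurent_on_trace_params less.IH)
  next
    case 2
    then show ?thesis
      by (cases "i = j") (simp_all add: laurent_on_const laurent_on_trace_params)
  qed (simp add: laurent_on_const)
qed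

lemma laurent_on_char_det: "laurent_on N (char_det N n)"
proof -
  have "laurent_on N (\<lambda>t. cheb_vec N (trace_params N t) m i)" for m i
    by (cases "m = 0") (simp_all add: cheb_vec_def laurent_on_const laurent_on_cheb)
  then have "laurent_on N (\<lambda>t. char_det N n t)"
    unfolding char_det_def det_mat_eq prod.case
    by (intro laurent_on_sum laurent_on_mult laurent_on_const laurent_on_prod)
  then show ?thesis by simp
qed

section \<open>Identifying the chosen Laurent polynomial by a limit\<close>

lemma laurent_polynomial_tendsto:
  assumes "laurent_polynomial N L" and "\<And>i. i \<in> {1..N} \<Longrightarrow> ((\<lambda>s. T s i) \<longlongrightarrow> t i) F"
    and "\<And>i. i \<in> {1..N} \<Longrightarrow> t i \<noteq> 0"
  shows "((\<lambda>s. L (T s)) \<longlongrightarrow> L t) F"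
proof -
  obtain K c where K: "\<And>t. L t = (\<Sum>k\<in>K. c k * (\<Prod>i = 1..N. t i powi k i))"
    using assms(1) unfolding laurent_polynomial_def by blast
  have "((\<lambda>s. T s i powi m) \<longlongrightarrow> t i powi m) F" if i: "i \<in> {1..N}" for i m
    by (rule tendsto_power_int[OF assms(2)[OF i] assms(3)[OF i]])
  then show ?thesis
    unfolding K by (intro tendsto_sum tendsto_mult tendsto_const tendsto_prod)
qed

lemma eventually_poly_nonzero:
  fixes p :: "complex poly"
  assumes "p \<noteq> 0"
  shows "eventually (\<lambda>s. poly p s \<noteq> 0) (at a)"
proof -
  have "finite ({s. poly p s = 0} - {a})"
    using poly_roots_finite[OF assms] by simp
  then have "open (- ({s. poly p s = 0} - {a}))"
    by (intro open_Compl finite_imp_closed)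
  then show ?thesis
    unfolding eventually_at_topological by (intro exI[of _ "- ({s. poly p s = 0} - {a})"]) auto
qed

lemma add_inverse_neq:
  fixes a b :: complex
  assumes "a \<noteq> 0" "b \<noteq> 0" "(a - b) * (a * b - 1) \<noteq> 0"
  shows "a + inverse a - (b + inverse b) \<noteq> 0"
proof -
  have "a + inverse a - (b + inverse b) = (a - b) * (a * b - 1) / (a * b)"
    using assms(1,2) by (simp add: field_simps)
  then show ?thesis using assms by simp
qed

text \<open>On the curve \<open>s \<mapsto> (t i + i s)\<close> two parameters can only coincide or be mutually inverse for
  finitely many \<open>s\<close>, so every point is a limit of points where the denominator does not vanish.\<close>

lemma eventually_char_denom_nonzero:
  assumes t: "\<forall>i\<in>{1..N}. t i \<noteq> 0"
  shows "eventually (\<lambda>s. (\<forall>i\<in>{1..N}. t i + of_nat i * s \<noteq> 0) \<and>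
    char_denom N (\<lambda>i. t i + of_nat i * s) \<noteq> 0) (at 0)"
proof -
  have "eventually (\<lambda>s. \<forall>i\<in>{1..N}. poly [:t i, of_nat i:] s \<noteq> 0) (at 0)"
    using t by (intro eventually_ball_finite ballI eventually_poly_nonzero) auto
  moreover have "eventually (\<lambda>s. \<forall>(i, j)\<in>{(i, j). i \<in> {1..N} \<and> j \<in> {1..N} \<and> i \<noteq> j}.
      poly ([:t i - t j, of_nat i - of_nat j:] * ([:t i, of_nat i:] * [:t j, of_nat j:] - 1)) s \<noteq> 0) (at 0)"
  proof (intro eventually_ball_finite ballI, goal_cases)
    case 1
    show ?case by (rule finite_subset[of _ "{1..N} \<times> {1..N}"]) auto
  next
    case (2 ij)
    obtain i j where ij: "ij = (i, j)" "i \<in> {1..N}" "j \<in> {1..N}" "i \<noteq> j" using 2 by auto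
    \<comment> \<open>The slopes i of the curve are nonzero and distinct: the first makes the
      coefficient of s^2 nonzero, the second keeps the linear factor from vanishing
      identically.\<close>
    have "coeff ([:t i, of_nat i:] * [:t j, of_nat j:] - 1) 2 = of_nat i * of_nat j"
      by (simp add: numeral_2_eq_2)
    also have "\<dots> \<noteq> (0 :: complex)" using ij by auto
    finally have "[:t i, of_nat i:] * [:t j, of_nat j:] - 1 \<noteq> 0" by auto
    moreover have "[:t i - t j, of_nat i - of_nat j:] \<noteq> 0" using ij by auto
    ultimately have "[:t i - t j, of_nat i - of_nat j:] * ([:t i, of_nat i:] * [:t j, of_nat j:] - 1) \<noteq> 0"
      by (simp only: mult_eq_0_iff de_Morgan_disj not_False_eq_True simp_thms)
    from eventually_poly_nonzero[OF this] show ?case by (simp add: ij)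
  qed
  ultimately show ?thesis
  proof eventually_elim
    case (elim s)
    let ?T = "\<lambda>i. t i + of_nat i * s"
    have nz: "\<forall>i\<in>{1..N}. ?T i \<noteq> 0" using elim(1) by (simp add: mult.commute)
    have neq: "trace_params N ?T i - trace_params N ?T k \<noteq> 0" if ik: "i < N" "k \<in> {Suc i..<N}" for i k
    proof -
      have lin: "poly [:t j, of_nat j:] s = ?T j" for j
        by (simp add: mult.commute)
      have diff: "poly [:t (Suc i) - t (Suc k), of_nat (Suc i) - of_nat (Suc k):] s = ?T (Suc i) - ?T (Suc k)"
        by (simp add: algebra_simps)
      have "(Suc i, Suc k) \<in> {(i, j). i \<in> {1..N} \<and> j \<in> {1..N} \<and> i \<noteq> j}"
        using ik by auto
      from bspec[OF elim(2) this, unfolded prod.case]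
      have "(?T (Suc i) - ?T (Suc k)) * (?T (Suc i) * ?T (Suc k) - 1) \<noteq> 0"
        unfolding poly_mult poly_diff poly_1 lin diff .
      moreover have "?T (Suc i) \<noteq> 0"
        by (rule bspec[OF nz]) (use ik in auto)
      moreover have "?T (Suc k) \<noteq> 0"
        by (rule bspec[OF nz]) (use ik in auto)
      moreover have "trace_params N ?T i = ?T (Suc i) + inverse (?T (Suc i))"
        "trace_params N ?T k = ?T (Suc k) + inverse (?T (Suc k))"
        using ik by (simp_all add: trace_params_def)
      ultimately show ?thesis
        by (simp only: add_inverse_neq not_False_eq_True)
    qed
    have "char_denom N ?T \<noteq> 0"
      unfolding char_denom_eq[OF nz] det_cheb_eigvec prod_zero_iff[OF finite_lessThan]
        prod_zero_iff[OF finite_atLeastLessThan]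
    proof
      assume "\<exists>i\<in>{..<N}. \<exists>k\<in>{Suc i..<N}. trace_params N ?T i - trace_params N ?T k = 0"
      then obtain i k where "i \<in> {..<N}" "k \<in> {Suc i..<N}"
        "trace_params N ?T i - trace_params N ?T k = 0"
        by (elim bexE)
      then show False
        using neq[of i k] by (simp only: lessThan_iff)
    qed
    with nz show ?case by (rule conjI)
  qed
qed

text \<open>The determinant \<open>char_det\<close> is one Laurent polynomial with the required
  values, so the choice is meaningful. The chosen one agrees with it near t along a curve that
  avoids the zeros of the denominator, hence at t by continuity.\<close>

lemma char_laurent_eq:
  assumes t: "\<forall>i\<in>{1..N}. t i \<noteq> 0"
  shows "char_laurent N n t = char_det N n t"
proof -
  obtain M where M: "laurent_polynomial N M" "\<forall>t. (\<forall>i\<in>{1..N}. t i \<noteq> 0) \<longrightarrow> char_det N n t = M t"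
    using laurent_on_char_det[of N n] unfolding laurent_on_def by blast
  have M_quot: "M t = char_numer N n t / char_denom N t"
    if t: "\<forall>i\<in>{1..N}. t i \<noteq> 0" "char_denom N t \<noteq> 0" for t
    using char_numer_eq[OF t(1), of n] M(2) t by simp
  define L where "L = char_laurent N n"
  have "laurent_polynomial N L \<and> (\<forall>t. (\<forall>i\<in>{1..N}. t i \<noteq> 0) \<and> char_denom N t \<noteq> 0 \<longrightarrow>
        L t = char_numer N n t / char_denom N t)"
    unfolding L_def char_laurent_def by (rule someI[of _ M]) (use M(1) M_quot in blast)
  then have L: "laurent_polynomial N L"
    "\<And>t. \<forall>i\<in>{1..N}. t i \<noteq> 0 \<Longrightarrow> char_denom N t \<noteq> 0 \<Longrightarrow> L t = char_numer N n t / char_denom N t"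
    by blast+
  let ?T = "\<lambda>s i. t i + of_nat i * s"
  have lim: "((\<lambda>s. ?T s i) \<longlongrightarrow> t i) (at 0)" for i
    by (auto intro!: tendsto_eq_intros)
  have "eventually (\<lambda>s. L (?T s) = M (?T s)) (at 0)"
    using eventually_char_denom_nonzero[OF t] by eventually_elim (simp add: L(2) M_quot)
  moreover have "((\<lambda>s. L (?T s)) \<longlongrightarrow> L t) (at 0)"
    by (rule laurent_polynomial_tendsto[OF L(1) lim]) (use t in auto)
  ultimately have "((\<lambda>s. M (?T s)) \<longlongrightarrow> L t) (at 0)"
    by (simp add: tendsto_cong)
  moreover have "((\<lambda>s. M (?T s)) \<longlongrightarrow> M t) (at 0)"
    by (rule laurent_polynomial_tendsto[OF M(1) lim]) (use t in auto)
  ultimately have "L t = M t"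
    by (rule tendsto_unique[rotated]) simp
  then show ?thesis using M(2) t by (simp add: L_def)
qed

section \<open>Eigenvalues of special orthogonal matrices\<close>

lemma similar_mat_wit_trace:
  fixes A :: "'a::comm_ring_1 mat"
  assumes "similar_mat_wit A B P Q"
  shows "mat_trace A = mat_trace B"
proof -
  define n where "n = dim_row A"
  have c: "A \<in> carrier_mat n n" "B \<in> carrier_mat n n" "P \<in> carrier_mat n n" "Q \<in> carrier_mat n n"
    and QP: "Q * P = 1\<^sub>m n" and A: "A = P * B * Q"
    using assms unfolding similar_mat_wit_def n_def Let_def insert_subset by blast+
  have comm: "mat_trace (X * Y) = mat_trace (Y * X)"
    if X: "X \<in> carrier_mat n n" and Y: "Y \<in> carrier_mat n n" for X Y :: "'a mat"
  proof -
    have "mat_trace (X * Y) = (\<Sum>i<n. \<Sum>k<n. X $$ (i, k) * Y $$ (k, i))"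
      using X Y by (simp add: mat_trace_def scalar_prod_def atLeast0LessThan)
    also have "\<dots> = (\<Sum>k<n. \<Sum>i<n. X $$ (i, k) * Y $$ (k, i))"
      by (rule sum.swap)
    also have "\<dots> = mat_trace (Y * X)"
      using X Y by (simp add: mat_trace_def scalar_prod_def atLeast0LessThan mult.commute)
    finally show ?thesis .
  qed
  have "mat_trace A = mat_trace (Q * (P * B))"
    unfolding A using c by (intro comm) auto
  also have "Q * (P * B) = (Q * P) * B"
    using c by (intro assoc_mult_mat[symmetric]) auto
  also have "\<dots> = B" using c by (simp add: QP)
  finally show ?thesis .
qed

text \<open>The Schur decomposition puts the listed roots on the diagonal of a similar triangular
  matrix.\<close>

lemma trace_eq_sum_list_roots:
  fixes A :: "complex mat"
  assumes A: "A \<in> carrier_mat n n" and p: "char_poly A = (\<Prod>a\<leftarrow>es. [:- a, 1:])"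
  shows "mat_trace A = sum_list es"
proof -
  obtain B P Q where BPQ: "schur_decomposition A es = (B, P, Q)"
    by (cases "schur_decomposition A es") auto
  from schur_decomposition[OF A p BPQ]
  have sim: "similar_mat_wit A B P Q" and es: "diag_mat B = es" by auto
  have "mat_trace A = mat_trace B" by (rule similar_mat_wit_trace[OF sim])
  also have "\<dots> = sum_list (diag_mat B)"
    unfolding mat_trace_def diag_mat_def by (simp add: sum_list_sum_nth atLeast0LessThan)
  finally show ?thesis by (simp add: es)
qed

lemma prod_list_concat_pairs:
  "(\<Prod>a\<leftarrow>concat (map (\<lambda>i. [f i, g i]) is). h a) = (\<Prod>i\<leftarrow>is. h (f i) * (h (g i) :: 'a::comm_monoid_mult))"
  by (induction "is") (simp_all add: mult.assoc)

lemma eigenvalue_params_trace: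
  assumes R: "R \<in> carrier_mat (2 * N) (2 * N)" and t: "eigenvalue_params N R t"
  shows "complex_of_real (mat_trace R) = (\<Sum>i<N. trace_params N t i)"
proof -
  let ?A = "map_mat complex_of_real R"
  let ?es = "concat (map (\<lambda>i. [t (Suc i), inverse (t (Suc i))]) [0..<N])"
  have "char_poly ?A = (\<Prod>i=1..N. [:- t i, 1:] * [:- inverse (t i), 1:])"
    using t unfolding eigenvalue_params_def by simp
  also have "\<dots> = (\<Prod>i<N. [:- t (Suc i), 1:] * [:- inverse (t (Suc i)), 1:])"
    by (rule prod.reindex_bij_witness[of _ Suc "\<lambda>i. i - 1"]) auto
  also have "\<dots> = (\<Prod>i\<leftarrow>[0..<N]. [:- t (Suc i), 1:] * [:- inverse (t (Suc i)), 1:])"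
    by (simp only: prod.distinct_set_conv_list[symmetric] distinct_upt set_upt atLeast0LessThan)
  also have "\<dots> = (\<Prod>a\<leftarrow>?es. [:- a, 1:])"
    by (rule prod_list_concat_pairs[symmetric])
  finally have "mat_trace ?A = sum_list ?es"
    using R by (intro trace_eq_sum_list_roots[of _ "2 * N"]) auto
  also have "\<dots> = (\<Sum>i\<leftarrow>[0..<N]. t (Suc i) + inverse (t (Suc i)))"
  proof -
    have "sum_list (concat (map (\<lambda>i. [f i, g i]) is)) = (\<Sum>i\<leftarrow>is. f i + g i)" for f g :: "nat \<Rightarrow> complex" and "is"
      by (induction "is") (simp_all add: add.assoc)
    then show ?thesis .
  qed
  also have "\<dots> = (\<Sum>i<N. t (Suc i) + inverse (t (Suc i)))"
    by (simp only: sum.distinct_set_conv_list[symmetric] distinct_upt set_upt atLeast0LessThan)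
  also have "\<dots> = (\<Sum>i<N. trace_params N t i)"
    by (intro sum.cong) (auto simp: trace_params_def)
  also have "mat_trace ?A = complex_of_real (mat_trace R)"
    using R by (simp add: mat_trace_def)
  finally show ?thesis .
qed

text \<open>A real orthogonal matrix preserves the Hermitian norm of complex vectors; comparing the
  norms of v and k v gives |k| = 1.\<close>

lemma orthogonal_eigenvalue_norm:
  assumes R: "R \<in> special_orthogonal n" and ev: "eigenvalue (map_mat complex_of_real R) k"
  shows "norm k = 1"
proof -
  let ?A = "map_mat complex_of_real R"
  have Rc: "R \<in> carrier_mat n n" and RR: "R * transpose_mat R = 1\<^sub>m n"
    using R unfolding special_orthogonal_def by auto
  have tR: "transpose_mat R \<in> carrier_mat n n" using Rc by simp
  have RtR: "transpose_mat R * R = 1\<^sub>m n"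
    by (rule mat_mult_left_right_inverse[OF Rc tR RR])
  obtain v where v: "v \<in> carrier_vec n" "v \<noteq> 0\<^sub>v n" "?A *\<^sub>v v = k \<cdot>\<^sub>v v"
    using ev Rc unfolding eigenvalue_def eigenvector_def by auto
  have orth: "(\<Sum>i<n. R $$ (i, j) * R $$ (i, l)) = (if j = l then 1 else 0)" if "j < n" "l < n" for j l
  proof -
    have "(transpose_mat R * R) $$ (j, l) = (\<Sum>i<n. R $$ (i, j) * R $$ (i, l))"
      using Rc that by (simp add: scalar_prod_def atLeast0LessThan)
    then show ?thesis using that by (simp add: RtR)
  qed
  have row: "(\<Sum>j<n. complex_of_real (R $$ (i, j)) * v $ j) = k * v $ i" if "i < n" for i
  proof -
    have "(?A *\<^sub>v v) $ i = (\<Sum>j<n. complex_of_real (R $$ (i, j)) * v $ j)"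
      using Rc v(1) that by (simp add: scalar_prod_def atLeast0LessThan)
    then show ?thesis using v(1) v(3) that by simp
  qed
  have "(\<Sum>i<n. (k * v $ i) * cnj (k * v $ i))
      = (\<Sum>i<n. (\<Sum>j<n. of_real (R $$ (i, j)) * v $ j) * (\<Sum>l<n. of_real (R $$ (i, l)) * cnj (v $ l)))"
  proof (rule sum.cong[OF refl])
    fix i assume "i \<in> {..<n}"
    then have e: "k * v $ i = (\<Sum>j<n. of_real (R $$ (i, j)) * v $ j)" using row by simp
    show "(k * v $ i) * cnj (k * v $ i)
      = (\<Sum>j<n. of_real (R $$ (i, j)) * v $ j) * (\<Sum>l<n. of_real (R $$ (i, l)) * cnj (v $ l))"
      unfolding e by simp
  qed
  also have "\<dots> = (\<Sum>i<n. \<Sum>j<n. \<Sum>l<n. of_real (R $$ (i, j) * R $$ (i, l)) * (v $ j * cnj (v $ l)))"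
    unfolding sum_product by (intro sum.cong refl) (simp add: mult_ac)
  \<comment> \<open>The row index i is moved innermost, where orthonormality of the columns
    collapses the sum.\<close>
  also have "\<dots> = (\<Sum>j<n. \<Sum>i<n. \<Sum>l<n. of_real (R $$ (i, j) * R $$ (i, l)) * (v $ j * cnj (v $ l)))"
    by (rule sum.swap)
  also have "\<dots> = (\<Sum>j<n. \<Sum>l<n. \<Sum>i<n. of_real (R $$ (i, j) * R $$ (i, l)) * (v $ j * cnj (v $ l)))"
    by (rule sum.cong[OF refl]) (rule sum.swap)
  also have "\<dots> = (\<Sum>j<n. \<Sum>l<n. of_real (\<Sum>i<n. R $$ (i, j) * R $$ (i, l)) * (v $ j * cnj (v $ l)))"
    by (simp only: of_real_sum sum_distrib_right)
  also have "\<dots> = (\<Sum>j<n. \<Sum>l<n. if j = l then v $ j * cnj (v $ l) else 0)"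
    by (intro sum.cong refl) (simp add: orth)
  also have "\<dots> = (\<Sum>j<n. v $ j * cnj (v $ j))"
    by (intro sum.cong refl) (simp add: sum.delta)
  finally have "(k * cnj k) * (\<Sum>j<n. v $ j * cnj (v $ j)) = (\<Sum>j<n. v $ j * cnj (v $ j))"
    by (simp add: sum_distrib_left mult_ac)
  moreover have "(\<Sum>j<n. v $ j * cnj (v $ j)) \<noteq> 0"
  proof
    assume "(\<Sum>j<n. v $ j * cnj (v $ j)) = 0"
    then have "of_real (\<Sum>j<n. (norm (v $ j))\<^sup>2) = (0 :: complex)"
      by (simp add: complex_norm_square[symmetric] del: of_real_power)
    then have "(\<Sum>j<n. (norm (v $ j))\<^sup>2) = 0"
      by (simp only: of_real_eq_0_iff)
    then have "\<forall>j\<in>{..<n}. (norm (v $ j))\<^sup>2 = 0"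
      by (subst (asm) sum_nonneg_eq_0_iff) auto
    then have "v = 0\<^sub>v n"
      using v(1) by (intro eq_vecI) auto
    with v(2) show False by simp
  qed
  ultimately have "k * cnj k = 1" by simp
  then have "complex_of_real ((norm k)\<^sup>2) = 1"
    by (simp only: complex_norm_square)
  then have "(norm k)\<^sup>2 = 1" by (simp only: of_real_eq_1_iff)
  then show ?thesis by (simp add: power2_eq_1_iff) (metis norm_ge_zero not_one_le_zero neg_0_le_iff_le)
qed

section \<open>Factorization of real polynomials with all roots on the unit circle\<close>

lemma map_poly_cnj_mult: "map_poly cnj (p * q) = map_poly cnj p * map_poly cnj q"
  by (rule poly_eq_poly_eq_iff[THEN iffD1], rule ext) simp

lemma monic_poly_unique_root:
  fixes p :: "complex poly"
  assumes "lead_coeff p = 1" and roots: "\<And>z. poly p z = 0 \<Longrightarrow> z = a"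
  shows "p = [:- a, 1:] ^ degree p"
proof -
  obtain as where as: "Polynomial.smult (lead_coeff p) (\<Prod>a\<leftarrow>as. [:- a, 1:]) = p" "length as = degree p"
    using fundamental_theorem_algebra_factorized[of p] by blast
  then have p: "p = (\<Prod>a\<leftarrow>as. [:- a, 1:])" using assms(1) by simp
  have "poly p b = 0" if "b \<in> set as" for b
    unfolding p using that by (induction as) auto
  then have "as = replicate (degree p) a"
    using as(2) roots by (intro replicate_eqI) auto
  with p show ?thesis by simp
qed

lemma monic_mult_degree:
  fixes q :: "complex poly"
  assumes "lead_coeff (r * q) = 1" "degree (r * q) = n + degree r" "lead_coeff r = 1"
  shows "lead_coeff q = 1" "degree q = n"
proof -
  show "lead_coeff q = 1" using assms(1,3) by (simp add: lead_coeff_mult)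
  then have "q \<noteq> 0" "r \<noteq> 0" using assms(3) by auto
  then show "degree q = n" using assms(2) by (simp add: degree_mult_eq)
qed

text \<open>A nonreal root comes with its conjugate. If all roots are real, they are 1 or -1, and a
  root has to be shown to be multiple so that it can serve as its own conjugate.\<close>

lemma unimodular_real_poly_has_conjugate_factor:
  fixes p :: "complex poly"
  assumes monic: "lead_coeff p = 1" and deg: "degree p = 2 * Suc N" and real: "map_poly cnj p = p"
    and roots: "\<And>z. poly p z = 0 \<Longrightarrow> norm z = 1" and p0: "poly p 0 = 1"
  obtains r q where "poly p r = 0" "p = [:- r, 1:] * [:- cnj r, 1:] * q"
proof -
  note witness = that
  have fta: "\<exists>z. poly q z = 0" if "degree q \<noteq> 0" for q :: "complex poly"
    using fundamental_theorem_of_algebra[of q] that by (auto simp: constant_degree)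
  have factor: "\<exists>p1. p = [:- r, 1:] * p1" if "poly p r = 0" for r
    using that unfolding poly_eq_0_iff_dvd dvd_def .
  have finish: thesis if r: "poly p r = 0" "p = [:- r, 1:] * p1" and c: "poly p1 (cnj r) = 0" for r p1
  proof -
    obtain q where q: "p1 = [:- cnj r, 1:] * q"
      using c unfolding poly_eq_0_iff_dvd dvd_def by blast
    show thesis by (rule witness[OF r(1)]) (simp only: r(2) q mult.assoc)
  qed
  show thesis
  proof (cases "\<exists>r. poly p r = 0 \<and> cnj r \<noteq> r")
    case True
    then obtain r where r: "poly p r = 0" "cnj r \<noteq> r" by blast
    obtain p1 where p1: "p = [:- r, 1:] * p1" using factor[OF r(1)] by blast
    have "poly p (cnj r) = cnj (poly p r)"
      using poly_map_poly_cnj[of p "cnj r"] real by simp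
    then have "(cnj r - r) * poly p1 (cnj r) = 0"
      using r(1) unfolding p1 by (simp add: disj_commute)
    then have "poly p1 (cnj r) = 0" using r(2) by simp
    then show thesis by (rule finish[OF r(1) p1])
  next
    case False
    have pm: "z = 1 \<or> z = - 1" if z: "poly p z = 0" for z
    proof -
      have "z * cnj z = 1"
        using roots[OF z] by (simp add: complex_norm_square[symmetric])
      then have "z * z = 1" using False z by auto
      then show ?thesis by (simp add: square_eq_1_iff)
    qed
    obtain r where r: "poly p r = 0" using fta[of p] deg by auto
    obtain p1 where p1: "p = [:- r, 1:] * p1" using factor[OF r] by blast
    have p1_monic: "lead_coeff p1 = 1" "degree p1 = 2 * N + 1"
      using monic_mult_degree[of "[:- r, 1:]" p1 "2 * N + 1"] monic deg p1 by simp_all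
    have "poly p1 r = 0"
    proof (rule ccontr)
      assume nr: "poly p1 r \<noteq> 0"
      \<comment> \<open>If r were simple, the other 2 N + 1 roots would all be -r. The product of
        all roots would then be -1, against the constant term 1.\<close>
      have "z = - r" if z: "poly p1 z = 0" for z
      proof -
        have "poly p z = 0" using z by (simp add: p1)
        then have "z = 1 \<or> z = - 1" by (rule pm)
        moreover have "z \<noteq> r" using z nr by blast
        ultimately show ?thesis using pm[OF r] by auto
      qed
      from monic_poly_unique_root[OF p1_monic(1) this]
      have "p1 = [:r, 1:] ^ (2 * N + 1)" by (simp add: p1_monic(2))
      then have "poly p 0 = - ((r * r) ^ Suc N)"
        unfolding p1 by (simp add: power_mult power2_eq_square poly_power)
      also have "r * r = 1" using pm[OF r] by auto
      finally show False using p0 by simp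
    qed
    moreover have "cnj r = r" using False r by blast
    ultimately show thesis using finish[OF r p1] by simp
  qed
qed

text \<open>Splitting off a conjugate pair preserves all hypotheses: the quadratic factor is real
  and, as r times its conjugate is 1, has constant term 1. On the unit circle the conjugate is the
  inverse.\<close>

lemma unimodular_real_poly_factorization:
  fixes p :: "complex poly"
  assumes "lead_coeff p = 1" "degree p = 2 * N" "map_poly cnj p = p"
    and "\<And>z. poly p z = 0 \<Longrightarrow> norm z = 1" "poly p 0 = 1"
  shows "\<exists>t. (\<forall>i\<in>{1..N}. norm (t i) = 1) \<and> p = (\<Prod>i=1..N. [:- t i, 1:] * [:- inverse (t i), 1:])"
  using assms
proof (induction N arbitrary: p)
  case 0
  then have "p = 1" by (metis lead_coeff_pCons(2) degree_0_id mult_zero_right monic_degree_0)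
  then show ?case by simp
next
  case (Suc N)
  obtain r q where r: "poly p r = 0" and pq: "p = [:- r, 1:] * [:- cnj r, 1:] * q"
    using unimodular_real_poly_has_conjugate_factor[OF Suc.prems] by metis
  define Q where "Q = [:- r, 1:] * [:- cnj r, 1:]"
  have q: "p = Q * q" unfolding Q_def by (rule pq)
  have nr: "norm r = 1" by (rule Suc.prems(4)[OF r])
  have rr: "r * cnj r = 1" using nr by (simp add: complex_norm_square[symmetric])
  have Q: "lead_coeff Q = 1" "degree Q = 2" by (simp_all add: Q_def)
  have q_monic: "lead_coeff q = 1" "degree q = 2 * N"
    using monic_mult_degree[of Q q "2 * N"] Suc.prems(1,2) Q unfolding q by simp_all
  have "map_poly cnj Q = Q"
    unfolding Q_def by (rule poly_eq_poly_eq_iff[THEN iffD1], rule ext) (simp add: algebra_simps)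
  then have "Q * map_poly cnj q = Q * q"
    using Suc.prems(3) unfolding q map_poly_cnj_mult by simp
  moreover have "Q \<noteq> 0" using Q by auto
  ultimately have q_real: "map_poly cnj q = q" by simp
  have q_roots: "norm z = 1" if "poly q z = 0" for z
    by (rule Suc.prems(4)) (simp add: q that)
  have q0: "poly q 0 = 1"
    using Suc.prems(5) rr by (simp add: q Q_def mult.commute[of "cnj r"])
  obtain t where t: "\<forall>i\<in>{1..N}. norm (t i) = 1" "q = (\<Prod>i=1..N. [:- t i, 1:] * [:- inverse (t i), 1:])"
    using Suc.IH[OF q_monic q_real q_roots q0] by blast
  have inv: "inverse r = cnj r" using rr by (rule inverse_unique)
  let ?t = "t(Suc N := r)"
  have "(\<Prod>i=1..Suc N. [:- ?t i, 1:] * [:- inverse (?t i), 1:])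
      = (\<Prod>i=1..N. [:- ?t i, 1:] * [:- inverse (?t i), 1:]) * ([:- r, 1:] * [:- inverse r, 1:])"
    by (simp only: prod.nat_ivl_Suc' fun_upd_same) (simp add: mult.commute)
  also have "(\<Prod>i=1..N. [:- ?t i, 1:] * [:- inverse (?t i), 1:]) = q"
    unfolding t(2) by (intro prod.cong) auto
  finally have "p = (\<Prod>i=1..Suc N. [:- ?t i, 1:] * [:- inverse (?t i), 1:])"
    unfolding q Q_def inv by (simp only: mult.commute)
  moreover have "\<forall>i\<in>{1..Suc N}. norm (?t i) = 1"
    using t(1) nr by auto
  ultimately show ?case by blast
qed

lemma eigenvalue_params_exist:
  assumes R: "R \<in> special_orthogonal (2 * N)"
  shows "\<exists>t. eigenvalue_params N R t"
proof -
  let ?A = "map_mat complex_of_real R"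
  let ?p = "char_poly ?A"
  have Rc: "R \<in> carrier_mat (2 * N) (2 * N)" and det: "det R = 1"
    using R unfolding special_orthogonal_def by auto
  have Ac: "?A \<in> carrier_mat (2 * N) (2 * N)" using Rc by simp
  have hom: "?p = map_poly of_real (char_poly R)"
    by (rule of_real_hom.char_poly_hom[OF Rc])
  have "poly ?p 0 = complex_of_real (poly (char_poly R) 0)"
    unfolding hom by (metis of_real_0 of_real_hom.poly_map_poly)
  also have "poly (char_poly R) 0 = det (- R)"
  proof -
    have "char_matrix R 0 = R"
      using Rc by (intro eq_matI) (auto simp: char_matrix_def)
    then show ?thesis using char_poly_matrix[OF Rc, of 0] by simp
  qed
  \<comment> \<open>The dimension 2 N is even, so the sign has no effect on the determinant.\<close>
  also have "- R = (- 1) \<cdot>\<^sub>m R" by (rule eq_matI) auto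
  also have "det \<dots> = 1"
    using Rc det by (simp add: det_smult)
  finally have p0: "poly ?p 0 = 1" by simp
  have "map_poly cnj ?p = ?p"
    unfolding hom by (rule poly_eqI) (simp add: coeff_map_poly)
  moreover have "norm z = 1" if "poly ?p z = 0" for z
    using orthogonal_eigenvalue_norm[OF R] eigenvalue_root_char_poly[OF Ac] that by blast
  moreover have "degree ?p = 2 * N" "lead_coeff ?p = 1"
    using degree_monic_char_poly[OF Ac] by auto
  ultimately show ?thesis
    unfolding eigenvalue_params_def using unimodular_real_poly_factorization[of ?p N] p0 by blast
qed

section \<open>The character expansion\<close>

text \<open>Makes the subtraction of N - i on natural numbers exact when a strictly decreasing tuple
  is turned back into a weight, and the result weakly decreasing.\<close>

lemma decreasing_tuples_gap:
  assumes "\<nu> \<in> decreasing_tuples N" "j \<le> i" "i < N"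
  shows "\<nu> i + (i - j) \<le> \<nu> j"
  using assms(2,3)
proof (induction i rule: dec_induct)
  case (step i)
  then have "\<nu> (Suc i) < \<nu> i"
    using assms(1) by (simp add: decreasing_tuples_def)
  with step show ?case by simp
qed simp

lemma bij_betw_shifted_weight:
  "bij_betw (shifted_weight N) (weights N) (decreasing_tuples N)"
proof (rule bij_betwI[where g = "\<lambda>\<nu>. restrict (\<lambda>i. \<nu> (i - 1) - (N - i)) {1..N}"])
  show "shifted_weight N \<in> weights N \<rightarrow> decreasing_tuples N"
  proof
    fix n assume n: "n \<in> weights N"
    have "shifted_weight N n i < shifted_weight N n j" if ij: "i < N" "j < i" for i j
    proof -
      have "n (Suc i) \<le> n (Suc j)" using n ij unfolding weights_def by simp
      then show ?thesis using ij by (simp add: shifted_weight_def)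
    qed
    then show "shifted_weight N n \<in> decreasing_tuples N"
      unfolding decreasing_tuples_def by (simp add: shifted_weight_def)
  qed
  show "(\<lambda>\<nu>. restrict (\<lambda>i. \<nu> (i - 1) - (N - i)) {1..N}) \<in> decreasing_tuples N \<rightarrow> weights N"
  proof
    fix \<nu> assume \<nu>: "\<nu> \<in> decreasing_tuples N"
    have "\<nu> (j - 1) - (N - j) \<le> \<nu> (i - 1) - (N - i)" if ij: "i \<in> {1..N}" "j \<in> {1..N}" "i \<le> j" for i j
    proof -
      have "\<nu> (j - 1) + ((j - 1) - (i - 1)) \<le> \<nu> (i - 1)"
        by (rule decreasing_tuples_gap[OF \<nu>]) (use ij in auto)
      moreover have "1 \<le> i" "j \<le> N" using ij by simp_all
      ultimately show ?thesis using ij(3) by arith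
    qed
    then show "restrict (\<lambda>i. \<nu> (i - 1) - (N - i)) {1..N} \<in> weights N"
      unfolding weights_def by simp
  qed
  show "restrict (\<lambda>i. shifted_weight N n (i - 1) - (N - i)) {1..N} = n" if n: "n \<in> weights N" for n
  proof
    fix i show "restrict (\<lambda>i. shifted_weight N n (i - 1) - (N - i)) {1..N} i = n i"
    proof (cases "i \<in> {1..N}")
      case True
      then show ?thesis by (auto simp: shifted_weight_def)
    next
      case False
      moreover have "n \<in> {1..N} \<rightarrow>\<^sub>E UNIV" using n by (simp add: weights_def)
      ultimately have "n i = undefined" by (intro PiE_arb[of n])
      then show ?thesis using False by (simp only: restrict_apply if_False)
    qed
  qed
  show "shifted_weight N (restrict (\<lambda>i. \<nu> (i - 1) - (N - i)) {1..N}) = \<nu>"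
    if \<nu>: "\<nu> \<in> decreasing_tuples N" for \<nu>
  proof
    fix k show "shifted_weight N (restrict (\<lambda>i. \<nu> (i - 1) - (N - i)) {1..N}) k = \<nu> k"
    proof (cases "k \<in> {0..<N}")
      case True
      \<comment> \<open>Comparison with the last entry shows that \<nu> k is at least N - 1 - k, so
        the subtraction does not truncate.\<close>
      then have "\<nu> (N - 1) + (N - 1 - k) \<le> \<nu> k"
        by (intro decreasing_tuples_gap[OF \<nu>]) auto
      then show ?thesis using True by (simp add: shifted_weight_def)
    next
      case False
      moreover have "\<nu> \<in> {0..<N} \<rightarrow>\<^sub>E UNIV" using \<nu> by (simp add: decreasing_tuples_def)
      ultimately have "\<nu> k = undefined" by (intro PiE_arb[of \<nu>])
      then show ?thesis using False by (simp only: shifted_weight_def restrict_apply if_False)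
    qed
  qed
qed

text \<open>With 1-based i the row shift is N - i and the column index is n_j + N - j; their
  difference and sum are the indices of the theorem. The 1/2 of the last row comes out of every
  Leibniz product once.\<close>

lemma det_bessel_coeff:
  assumes "N \<ge> 1"
  shows "det (mat N N (\<lambda>(j, k). bessel_coeff N x j (shifted_weight N n k))) =
    1 / 2 * det1 N (\<lambda>i j. bessel_I (int (n j) + int i - int j) (2 * x)
                        + bessel_I (int (n j) + 2 * int N - int i - int j) (2 * x))"
proof -
  let ?h = "\<lambda>(i, j). bessel_I (int (n (j + 1)) + int (i + 1) - int (j + 1)) (2 * x)
      + bessel_I (int (n (j + 1)) + 2 * int N - int (i + 1) - int (j + 1)) (2 * x)"
  let ?c = "\<lambda>j. if j = N - 1 then 1 / 2 else 1 :: complex"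
  have entry: "bessel_coeff N x j (shifted_weight N n k) = ?c j * ?h (j, k)" if jk: "j < N" "k < N" for j k
  proof -
    have "int (shifted_weight N n k) - int (N - 1 - j) = int (n (k + 1)) + int (j + 1) - int (k + 1)"
      "int (shifted_weight N n k) + int (N - 1 - j)
        = int (n (k + 1)) + 2 * int N - int (j + 1) - int (k + 1)"
      using jk by (simp_all add: shifted_weight_def)
    then show ?thesis by (simp only: bessel_coeff_def prod.case)
  qed
  have "(\<Prod>j = 0..<N. bessel_coeff N x j (shifted_weight N n (\<sigma> j))) = 1 / 2 * (\<Prod>j = 0..<N. ?h (j, \<sigma> j))"
    if \<sigma>: "\<sigma> permutes {0..<N}" for \<sigma>
  proof -
    have "(\<Prod>j = 0..<N. bessel_coeff N x j (shifted_weight N n (\<sigma> j))) = (\<Prod>j = 0..<N. ?c j * ?h (j, \<sigma> j))"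
      by (rule prod.cong[OF refl], rule entry) (use permutes_in_image[OF \<sigma>] in auto)
    also have "\<dots> = (\<Prod>j = 0..<N. ?c j) * (\<Prod>j = 0..<N. ?h (j, \<sigma> j))"
      by (rule prod.distrib)
    also have "(\<Prod>j = 0..<N. ?c j) = 1 / 2"
      using assms by (simp add: prod.delta)
    finally show ?thesis .
  qed
  then have "(\<Sum>\<sigma> | \<sigma> permutes {0..<N}. signof \<sigma> * (\<Prod>j = 0..<N. bessel_coeff N x j (shifted_weight N n (\<sigma> j))))
      = (\<Sum>\<sigma> | \<sigma> permutes {0..<N}. 1 / 2 * (signof \<sigma> * (\<Prod>j = 0..<N. ?h (j, \<sigma> j))))"
    by (intro sum.cong refl) simp
  then show ?thesis
    unfolding det1_def det_mat_eq prod.case sum_distrib_left .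
qed

theorem mainTheorem6:
  fixes N :: nat and x :: complex and R :: "real mat"
  assumes "N \<ge> 1" and "R \<in> special_orthogonal (2 * N)"
  shows "((\<lambda>n. 1 / 2 *
            det1 N (\<lambda>i j. bessel_I (int (n j) + int i - int j) (2 * x)
                        + bessel_I (int (n j) + 2 * int N - int i - int j) (2 * x))
            * SO_char N n R)
          has_sum exp (x * complex_of_real (mat_trace R))) (weights N)"
proof -
  \<comment> \<open>This is the choice made inside \<open>SO_char\<close>, so trace and characters
    refer to the same parameters.\<close>
  define t where "t = (SOME t. eigenvalue_params N R t)"
  define z where "z = trace_params N t"
  have t: "eigenvalue_params N R t"
    unfolding t_def by (rule someI_ex[OF eigenvalue_params_exist[OF assms(2)]])
  have norm_t: "norm (t i) = 1" if "i \<in> {1..N}" for i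
    using t that unfolding eigenvalue_params_def by blast
  have t0: "\<forall>i\<in>{1..N}. t i \<noteq> 0"
    using norm_t by (metis norm_zero zero_neq_one)
  have char: "SO_char N n R = char_det N n t" for n
    unfolding SO_char_def t_def[symmetric] by (rule char_laurent_eq[OF t0])
  have trace: "complex_of_real (mat_trace R) = (\<Sum>i<N. z i)"
    unfolding z_def by (rule eigenvalue_params_trace[OF _ t])
      (use assms(2) in \<open>simp add: special_orthogonal_def\<close>)
  have "norm (z i) \<le> 2" for i
  proof (cases "i < N")
    case True
    then have "norm (t (Suc i)) = 1" by (intro norm_t) auto
    then show ?thesis
      using True norm_triangle_ineq[of "t (Suc i)" "inverse (t (Suc i))"]
      by (simp add: z_def trace_params_def norm_inverse)
  qed (simp add: z_def trace_params_def)
  moreover have "\<exists>w. w \<noteq> 0 \<and> z i = w + inverse w" if "i < N" for i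
    using t0 that by (intro exI[of _ "t (Suc i)"]) (auto simp: z_def trace_params_def)
  ultimately have "((\<lambda>\<nu>. det (mat N N (\<lambda>(j, k). bessel_coeff N x j (\<nu> k)))
        * det (mat N N (\<lambda>(k, i). cheb_vec N z (\<nu> k) i)))
    has_sum exp (x * (\<Sum>i<N. z i))) (decreasing_tuples N)"
    by (intro has_sum_bessel_cheb)
  from has_sum_reindex_bij_betw[OF bij_betw_shifted_weight, THEN iffD2, OF this]
  show ?thesis
    unfolding det_bessel_coeff[OF assms(1)] char char_det_def trace z_def .
qed

end
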